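(* Let $\mathcal C\subset \mathbb T^2$ be a smooth curve with nowhere-zero curvature, and let $F$ be a real-valued eigenfunction of the Laplacian on $\mathbb T^2$ with eigenvalue $\lambda^2$, that is, $-\Delta F=\lambda^2F$. Then $$\|F\|_{L^1(\mathcal C)}\ \gg_{\mathcal C}\ \frac{\|F\|_2^3}{\|F\|_{L^4(\mathcal C)}^2},$$ where the implied constant depends only on the curve $\mathcal C$.
   Context: $\mathbb T^2=\mathbb R^2/2\pi\mathbb Z^2$ is the standard flat torus and $\Delta$ is its Laplacian. The curve $\mathcal C$ has an arc-length parameterization $\gamma:[0,L]\to\mathcal C$, and $\|F\|_{L^p(\mathcal C)}^p=\int_{\mathcal C}|F|^p=\int_0^L|F(\gamma(t))|^p\,dt$; in particular $\|F\|_{L^1(\mathcal C)}=\int_{\mathcal C}|F|$. Also $\|F\|_2^2=\int_{\mathbb T^2}|F(x)|^2\,dx$. The notation $X\gg_{\mathcal C}Y$ means $X\ge cY$ for some constant $c>0$ depending only on $\mathcal C$.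
   Formalization: The bound is asserted only for eigenvalues λ² with λ ≥ Λ, where Λ depends only on the curve (for small λ an eigenfunction can vanish on the curve and the bound fails), and for F not identically zero; it is also shown that the L^4 norm of F on the curve is positive. *)

theory Defs
  imports "HOL-Analysis.Analysis"
begin

text \<open>
  Functions on the torus are functions on the plane with period lattice \<open>2 * pi * \<int>\<^sup>2\<close>.
\<close>

definition torus_periodic :: "(real ^ 2 \<Rightarrow> real) \<Rightarrow> bool" where
  "torus_periodic F \<longleftrightarrow>
     (\<forall>(k :: int ^ 2) x. F (x + (\<chi> i. 2 * pi * of_int (k $ i))) = F x)"

definition partial_deriv :: "2 \<Rightarrow> (real ^ 2 \<Rightarrow> real) \<Rightarrow> real ^ 2 \<Rightarrow> real" where
  "partial_deriv i F x = frechet_derivative F (at x) (axis i 1)"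

fun cont_diff :: "nat \<Rightarrow> (real ^ 2 \<Rightarrow> real) \<Rightarrow> bool" where
  "cont_diff 0 F \<longleftrightarrow> continuous_on UNIV F"
| "cont_diff (Suc k) F \<longleftrightarrow>
     (\<forall>x. F differentiable (at x)) \<and> (\<forall>i. cont_diff k (partial_deriv i F))"

definition laplacian :: "(real ^ 2 \<Rightarrow> real) \<Rightarrow> real ^ 2 \<Rightarrow> real" where
  "laplacian F x = (\<Sum>i\<in>UNIV. partial_deriv i (partial_deriv i F) x)"

text \<open>Here \<open>lam\<close> is the frequency: the eigenvalue is \<open>lam\<^sup>2\<close>.\<close>

definition torus_eigenfunction :: "real \<Rightarrow> (real ^ 2 \<Rightarrow> real) \<Rightarrow> bool" where
  "torus_eigenfunction lam F \<longleftrightarrow>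
     torus_periodic F \<and> cont_diff 2 F \<and> (\<exists>x. F x \<noteq> 0) \<and>
     (\<forall>x. - laplacian F x = lam\<^sup>2 * F x)"

definition torus_L2_norm :: "(real ^ 2 \<Rightarrow> real) \<Rightarrow> real" where
  "torus_L2_norm F = sqrt (integral (cbox 0 (\<chi> i. 2 * pi)) (\<lambda>x. \<bar>F x\<bar>\<^sup>2))"

text \<open>
  A curve on the torus is given by a lift \<open>\<gamma>\<close> to the plane of its arc-length parameterization
  on \<open>{0..L}\<close>. Derivatives at the end points are one-sided. The curve may be an arc or closed on
  the torus (\<open>\<gamma> L - \<gamma> 0\<close> in the period lattice), and self-intersections are allowed.
\<close>

definition curve_deriv :: "real \<Rightarrow> (real \<Rightarrow> real ^ 2) \<Rightarrow> real \<Rightarrow> real ^ 2" where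
  "curve_deriv L \<gamma> t = vector_derivative \<gamma> (at t within {0..L})"

definition smooth_on_interval :: "real \<Rightarrow> (real \<Rightarrow> real ^ 2) \<Rightarrow> bool" where
  "smooth_on_interval L \<gamma> \<longleftrightarrow>
     (\<forall>n. \<forall>t\<in>{0..L}. (curve_deriv L ^^ n) \<gamma> differentiable (at t within {0..L}))"

definition smooth_arclength_curve :: "real \<Rightarrow> (real \<Rightarrow> real ^ 2) \<Rightarrow> bool" where
  "smooth_arclength_curve L \<gamma> \<longleftrightarrow>
     0 < L \<and> smooth_on_interval L \<gamma> \<and> (\<forall>t\<in>{0..L}. norm (curve_deriv L \<gamma> t) = 1)"

text \<open>The curvature at \<open>t\<close>, for a curve parameterized by arc length.\<close>

definition curvature :: "real \<Rightarrow> (real \<Rightarrow> real ^ 2) \<Rightarrow> real \<Rightarrow> real" where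
  "curvature L \<gamma> t = norm (curve_deriv L (curve_deriv L \<gamma>) t)"

definition curve_Lp_norm ::
  "real \<Rightarrow> real \<Rightarrow> (real \<Rightarrow> real ^ 2) \<Rightarrow> (real ^ 2 \<Rightarrow> real) \<Rightarrow> real" where
  "curve_Lp_norm p L \<gamma> F = (integral {0..L} (\<lambda>t. \<bar>F (\<gamma> t)\<bar> powr p)) powr (1 / p)"

end

theory Submission
  imports Defs "HOL-Computational_Algebra.Primes"
begin

text \<open>
  The heart of the matter is a lower bound for the restriction to the curve in mean square
  (\<open>restriction_L2_lower_bound\<close>, due to Bourgain and Rudnick): for large \<open>lam\<close>, the integral of
  \<open>F^2\<close> over the curve is at least a constant times the squared norm of \<open>F\<close> on the torus. The
  theorem then follows by interpolating \<open>L^2\<close> of the curve between \<open>L^1\<close> and \<open>L^4\<close>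
  (\<open>integral_interpolation_1_2_4\<close>).

  For the restriction bound, \<open>F\<close> is a combination of the exponentials with frequencies at the
  lattice points of the circle of radius \<open>lam\<close> (\<open>torus_eigenfunction_expansion\<close>), and its norm is
  given by the coefficients (\<open>torus_L2_norm_expansion\<close>). The square integral over the curve
  is therefore a quadratic form in the coefficients with entries \<open>s (n - m)\<close>, where \<open>s\<close> is the
  Fourier transform of arc length. The diagonal entries are the length \<open>L\<close>. Nonvanishing curvature
  gives two facts about the others: \<open>s \<xi>\<close> decays like \<open>norm \<xi>\<close> to the power \<open>-1/2\<close>
  (\<open>curve_oscillatory_decay\<close>), and \<open>s\<close> is bounded by some \<open>\<rho> < L\<close> at all nonzero integer
  frequencies (\<open>curve_oscillatory_gap\<close>).

  Arithmetic separates the frequencies. Any three lattice points on the circle span a triangle of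
  area at least \<open>1/2\<close>, so two of them are at distance of order \<open>lam powr (1/3)\<close> at least; thus every
  frequency has at most one close neighbour (\<open>at_most_one_close_lattice_point\<close>). Pairs of close
  neighbours cost at most \<open>\<rho>\<close>. The other entries are at most of order \<open>lam powr (-1/6)\<close>, and there are
  few of them in each row, since the number of lattice points on the circle is controlled by the divisor
  function (\<open>card_lattice_circle\<close>, \<open>divisor_count_le_powr\<close>). Hence for large \<open>lam\<close> the quadratic form
  is bounded below by \<open>(L - \<rho>) / 2\<close> times the sum of squares of the coefficients.
\<close>

section \<open>The divisor bound\<close>

definition divisor_count :: "nat \<Rightarrow> nat" where "divisor_count n = card {d. d dvd n}"

lemma divisor_count_mult_le:
  assumes "m > 0" "n > 0"
  shows "divisor_count (m * n) \<le> divisor_count m * divisor_count n"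
proof -
  have sub: "{d. d dvd m * n} \<subseteq> (\<lambda>(a, b). a * b) ` ({d. d dvd m} \<times> {d. d dvd n})"
  proof
    fix d assume "d \<in> {d. d dvd m * n}"
    then obtain a b where "a dvd m" "b dvd n" "d = a * b"
      using division_decomp by blast
    then show "d \<in> (\<lambda>(a, b). a * b) ` ({d. d dvd m} \<times> {d. d dvd n})" by force
  qed
  have fin: "finite ({d. d dvd m} \<times> {d. d dvd n})" using assms by simp
  have "card {d. d dvd m * n} \<le> card ((\<lambda>(a, b). a * b) ` ({d. d dvd m} \<times> {d. d dvd n}))"
    using sub fin by (intro card_mono finite_imageI)
  also have "\<dots> \<le> card ({d. d dvd m} \<times> {d. d dvd n})" by (rule card_image_le[OF fin])
  finally show ?thesis by (simp add: divisor_count_def card_cartesian_product)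
qed

lemma divisor_count_prime_power_le:
  assumes "prime p" shows "divisor_count (p ^ a) \<le> a + 1"
proof -
  have "{d. d dvd p ^ a} \<subseteq> (\<lambda>i. p ^ i) ` {..a}"
    using divides_primepow_nat[OF assms] by auto
  then have "card {d. d dvd p ^ a} \<le> card ((\<lambda>i. p ^ i) ` {..a})" by (intro card_mono) auto
  also have "\<dots> \<le> card {..a}" by (rule card_image_le) simp
  finally show ?thesis by (simp add: divisor_count_def)
qed

text \<open>
  Submultiplicativity reduces to prime powers, where \<open>a + 1\<close> is compared with
  \<open>p\<close> to the power \<open>a * \<epsilon>\<close>. If \<open>p\<close> is so large that \<open>p powr \<epsilon> \<ge> 2\<close>, the comparison costs
  nothing, because \<open>a + 1 \<le> 2 ^ a\<close>. Each of the finitely many smaller primes costs a fixed factor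
  \<open>c\<close>, so the total loss is bounded independently of the number.
\<close>

lemma divisor_count_le_powr:
  fixes \<epsilon> :: real
  assumes "\<epsilon> > 0"
  shows "\<exists>C>0. \<forall>n>0. real (divisor_count n) \<le> C * real n powr \<epsilon>"
proof -
  define K where "K = nat \<lceil>2 powr (1 / \<epsilon>)\<rceil>"
  \<comment> \<open>With this \<open>c\<close>, \<open>a + 1 \<le> c * exp (a * \<epsilon> * ln 2)\<close> by \<open>1 + x \<le> exp x\<close>.\<close>
  define c where "c = max 1 (1 / (\<epsilon> * ln 2))"
  have c1: "c \<ge> 1" by (simp add: c_def)
  define S where "S = {p :: nat. p < K}"
  have key: "real (a + 1) \<le> (if p \<in> S then c else 1) * real (p ^ a) powr \<epsilon>"
    if p: "prime p" for p a :: nat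
  proof -
    have p2: "p \<ge> 2" using p by (rule prime_ge_2_nat)
    have e: "real (p ^ a) powr \<epsilon> = (real p powr \<epsilon>) ^ a"
      using p2 by (simp add: powr_powr powr_realpow[symmetric] mult.commute)
    show ?thesis
    proof (cases "p \<in> S")
      case True
      have "c * (\<epsilon> * ln 2) \<ge> 1"
      proof -
        have "1 / (\<epsilon> * ln 2) * (\<epsilon> * ln 2) = 1" using assms by simp
        moreover have "1 / (\<epsilon> * ln 2) * (\<epsilon> * ln 2) \<le> c * (\<epsilon> * ln 2)"
          using assms by (intro mult_right_mono) (auto simp: c_def)
        ultimately show ?thesis by linarith
      qed
      then have "real a * 1 \<le> real a * (c * (\<epsilon> * ln 2))" by (intro mult_left_mono) auto
      then have "real (a + 1) \<le> c * (1 + real a * (\<epsilon> * ln 2))"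
        using c1 by (simp add: algebra_simps)
      also have "\<dots> \<le> c * exp (real a * (\<epsilon> * ln 2))"
        using c1 by (intro mult_left_mono exp_ge_add_one_self) auto
      also have "exp (real a * (\<epsilon> * ln 2)) = (2 powr \<epsilon>) ^ a"
        by (simp add: powr_def exp_of_nat_mult)
      also have "c * (2 powr \<epsilon>) ^ a \<le> c * (real p powr \<epsilon>) ^ a"
        using c1 p2 assms by (intro mult_left_mono power_mono powr_mono2) auto
      finally show ?thesis using True e by simp
    next
      case False
      then have "K \<le> p" by (simp add: S_def)
      then have "real p \<ge> 2 powr (1 / \<epsilon>)"
        using real_nat_ceiling_ge[of "2 powr (1 / \<epsilon>)"] unfolding K_def
        by (meson of_nat_le_iff order_trans)
      then have "real p powr \<epsilon> \<ge> (2 powr (1 / \<epsilon>)) powr \<epsilon>"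
        using assms by (intro powr_mono2) auto
      then have "real p powr \<epsilon> \<ge> 2" using assms by (simp add: powr_powr)
      then have "(real p powr \<epsilon>) ^ a \<ge> 2 ^ a" by (intro power_mono) auto
      moreover have "real (a + 1) \<le> 2 ^ a"
      proof -
        have "a + 1 \<le> 2 ^ a" by (induction a) auto
        then show ?thesis by (metis of_nat_le_iff of_nat_numeral of_nat_power)
      qed
      ultimately show ?thesis using False e by simp
    qed
  qed
  have main: "real (divisor_count n) \<le> c ^ card (prime_factors n \<inter> S) * real n powr \<epsilon>" if "n > 0" for n
    using that
  proof (induction n rule: less_induct)
    case (less n)
    show ?case
    proof (cases "n = 1")
      case True
      then show ?thesis by (simp add: divisor_count_def)
    next
      case False
      then obtain p where p: "prime p" "p dvd n" using prime_factor_nat by blast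
      define a where "a = multiplicity p n"
      obtain m where m: "n = p ^ a * m" "\<not> p dvd m"
        using multiplicity_decompose'[of n p] less.prems p unfolding a_def
        by (metis not_prime_unit not_gr_zero)
      have a0: "a > 0" using p less.prems unfolding a_def
        by (metis multiplicity_eq_zero_iff not_gr_zero not_prime_unit)
      have m0: "m > 0" using m less.prems by (cases m) auto
      have "p ^ a > 1" using a0 p by (metis one_less_power prime_gt_1_nat)
      then have mn: "m < n" using m m0 by simp
      have pm: "p \<notin> prime_factors m" using m by auto
      have pf: "prime_factors n = insert p (prime_factors m)"
        using m m0 a0 p by (simp add: prime_factors_product prime_factorization_prime_power)
      have cc: "(if p \<in> S then c else 1) * c ^ card (prime_factors m \<inter> S)
          = c ^ card (prime_factors n \<inter> S)"
        using pf pm by (auto simp: Int_insert_left)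
      have "real (divisor_count n) \<le> real (divisor_count (p ^ a)) * real (divisor_count m)"
        using divisor_count_mult_le[of "p ^ a" m] m m0 p
        by (metis of_nat_le_iff of_nat_mult prime_gt_0_nat zero_less_power)
      also have "\<dots> \<le> ((if p \<in> S then c else 1) * real (p ^ a) powr \<epsilon>) *
          (c ^ card (prime_factors m \<inter> S) * real m powr \<epsilon>)"
      proof (intro mult_mono)
        show "real (divisor_count (p ^ a)) \<le> (if p \<in> S then c else 1) * real (p ^ a) powr \<epsilon>"
          using key[OF p(1), of a] divisor_count_prime_power_le[OF p(1), of a] by linarith
        show "real (divisor_count m) \<le> c ^ card (prime_factors m \<inter> S) * real m powr \<epsilon>"
          using less.IH[OF mn m0] .
      qed (use c1 in auto)
      also have "\<dots> = ((if p \<in> S then c else 1) * c ^ card (prime_factors m \<inter> S)) *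
          (real (p ^ a) powr \<epsilon> * real m powr \<epsilon>)" by (simp only: mult_ac)
      also have "\<dots> = c ^ card (prime_factors n \<inter> S) * real n powr \<epsilon>"
        unfolding cc m(1) by (subst powr_mult[symmetric]) auto
      finally show ?thesis .
    qed
  qed
  have "real (divisor_count n) \<le> c ^ K * real n powr \<epsilon>" if "n > 0" for n
  proof -
    have "card (prime_factors n \<inter> S) \<le> card S" by (intro card_mono) (auto simp: S_def)
    then have "c ^ card (prime_factors n \<inter> S) \<le> c ^ K"
      using c1 by (intro power_increasing) (auto simp: S_def)
    then show ?thesis using main[OF that] by (meson mult_right_mono order_trans powr_ge_zero)
  qed
  moreover have "c ^ K > 0" using c1 by auto
  ultimately show ?thesis by blast
qed

section \<open>Lattice points on circles\<close>

definition lattice_circle :: "nat \<Rightarrow> (int \<times> int) set" where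
  "lattice_circle n = {(x, y). x\<^sup>2 + y\<^sup>2 = int n}"

lemma card_le_fibers:
  assumes "finite B" "f ` A \<subseteq> B" "\<And>b. b \<in> B \<Longrightarrow> card {a \<in> A. f a = b} \<le> k"
  shows "card A \<le> card B * k"
proof -
  have "A = (\<Union>b\<in>B. {a \<in> A. f a = b})" using assms(2) by auto
  then have "card A \<le> (\<Sum>b\<in>B. card {a \<in> A. f a = b})"
    using card_UN_le[OF assms(1), of "\<lambda>b. {a \<in> A. f a = b}"] by simp
  also have "\<dots> \<le> (\<Sum>b\<in>B. k)" by (intro sum_mono assms(3))
  finally show ?thesis by simp
qed

lemma finite_lattice_circle: "finite (lattice_circle n)"
proof -
  have bd: "\<bar>x\<bar> \<le> int n" if "x\<^sup>2 + y\<^sup>2 = int n" for x y :: int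
  proof -
    have "\<bar>x\<bar> \<le> x\<^sup>2"
    proof (cases "x = 0")
      case False
      then have "\<bar>x\<bar> * 1 \<le> \<bar>x\<bar> * \<bar>x\<bar>" by (intro mult_left_mono) auto
      then show ?thesis by (simp add: power2_eq_square)
    qed auto
    then show ?thesis using that zero_le_power2[of y] by linarith
  qed
  then have "\<bar>fst p\<bar> \<le> int n \<and> \<bar>snd p\<bar> \<le> int n" if "p \<in> lattice_circle n" for p
    using that bd[of "fst p" "snd p"] bd[of "snd p" "fst p"]
    by (simp add: lattice_circle_def case_prod_beta add.commute)
  then have "lattice_circle n \<subseteq> {- int n..int n} \<times> {- int n..int n}"
    by (force simp: abs_le_iff)
  then show ?thesis by (rule finite_subset) simp
qed

lemma coprime_sum_squares:
  fixes x y :: int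
  assumes "coprime x y" "g dvd x\<^sup>2 + y\<^sup>2"
  shows "coprime g x" "coprime g y"
proof -
  have *: "coprime g x" if "coprime x y" "g dvd x\<^sup>2 + y\<^sup>2" for x y :: int
  proof (rule coprimeI)
    fix c assume c: "c dvd g" "c dvd x"
    have "c dvd x\<^sup>2 + y\<^sup>2" using c(1) that(2) dvd_trans by blast
    moreover have "c dvd x\<^sup>2" using c(2) by (simp add: power2_eq_square)
    ultimately have "c dvd y\<^sup>2" by (simp add: dvd_add_right_iff)
    moreover have "coprime x (y\<^sup>2)" using that(1) by simp
    ultimately show "is_unit c" using c(2) coprime_common_divisor by blast
  qed
  show "coprime g x" using *[OF assms] .
  show "coprime g y" using *[of y x] assms by (simp add: add.commute coprime_commute)
qed

lemma dvd_of_coprime_multiples: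
  fixes u v w d :: int
  assumes "coprime u v" "d dvd u * w" "d dvd v * w"
  shows "d dvd w"
proof -
  obtain s t where "s * u + t * v = 1" using bezout_int[of u v] assms(1) by auto
  then have "w = s * (u * w) + t * (v * w)" by (metis distrib_right mult.assoc mult_1)
  then show ?thesis using assms(2,3) by (metis dvd_add dvd_mult)
qed

text \<open>
  This replaces factorization in the Gaussian integers. Put \<open>A = x y0 - y x0\<close> and
  \<open>B = x y0 + y x0\<close>. Then \<open>A B = m (x^2 - x0^2)\<close>, so with \<open>d = gcd A m\<close> the cofactor \<open>m / d\<close>
  divides \<open>B\<close>. Hence, modulo \<open>d\<close>, both points are proportional to \<open>(x0, y0)\<close>, and modulo \<open>m / d\<close>
  both are proportional to its mirror image, so both moduli divide the cross product of the two
  points. By primitivity the two moduli share at most a factor \<open>2\<close>.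
\<close>

lemma same_gcd_dvd_cross:
  fixes x y x' y' x0 y0 m :: int
  assumes m: "m > 0" and n0: "x0\<^sup>2 + y0\<^sup>2 = m" and n1: "x\<^sup>2 + y\<^sup>2 = m" and n2: "x'\<^sup>2 + y'\<^sup>2 = m"
    and c0: "coprime x0 y0" and c1: "coprime x y" and c2: "coprime x' y'"
    and eq: "gcd (x * y0 - y * x0) m = gcd (x' * y0 - y' * x0) m"
  shows "m dvd 2 * (x * y' - x' * y)"
proof -
  define d where "d = gcd (x * y0 - y * x0) m"
  define e where "e = m div d"
  define W where "W = x * y' - x' * y"
  have dm: "d dvd m" by (simp add: d_def)
  have mde: "m = d * e" using dm by (simp add: e_def)
  have d0: "d \<noteq> 0" using m by (simp add: d_def)
  have e_dvd: "e dvd p * y0 + q * x0"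
    if "p\<^sup>2 + q\<^sup>2 = m" "gcd (p * y0 - q * x0) m = d" for p q
  proof -
    define A where "A = p * y0 - q * x0"
    have "A * (p * y0 + q * x0) = m * (p\<^sup>2 - x0\<^sup>2)"
    proof -
      have "A * (p * y0 + q * x0) = p\<^sup>2 * y0\<^sup>2 - q\<^sup>2 * x0\<^sup>2" unfolding A_def by algebra
      moreover have "q\<^sup>2 = m - p\<^sup>2" "y0\<^sup>2 = m - x0\<^sup>2" using that(1) n0 by auto
      ultimately show ?thesis by (simp add: algebra_simps)
    qed
    then have "d * e dvd A * (p * y0 + q * x0)" using mde by simp
    moreover have "A = d * (A div d)" using that(2) A_def by (metis dvd_mult_div_cancel gcd_dvd1)
    ultimately have "d * e dvd d * ((A div d) * (p * y0 + q * x0))" by (metis mult.assoc)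
    then have "e dvd (A div d) * (p * y0 + q * x0)" using d0 by simp
    moreover have "coprime e (A div d)"
      using div_gcd_coprime[of A m] that(2) m unfolding A_def e_def
      by (simp add: coprime_commute)
    ultimately show ?thesis by (simp add: coprime_dvd_mult_right_iff)
  qed
  have A1: "d dvd x * y0 - y * x0" by (simp add: d_def)
  have A2: "d dvd x' * y0 - y' * x0" by (simp add: d_def eq)
  have B1: "e dvd x * y0 + y * x0" using e_dvd[OF n1] d_def by simp
  have B2: "e dvd x' * y0 + y' * x0" using e_dvd[OF n2] eq d_def by simp
  have dW: "d dvd W"
  proof (rule dvd_of_coprime_multiples[OF c0])
    have "x0 * W = x' * (x * y0 - y * x0) - x * (x' * y0 - y' * x0)"
      by (simp add: W_def algebra_simps)
    then show "d dvd x0 * W" using A1 A2 by simp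
    have "y0 * W = y' * (x * y0 - y * x0) - y * (x' * y0 - y' * x0)"
      by (simp add: W_def algebra_simps)
    then show "d dvd y0 * W" using A1 A2 by simp
  qed
  have eW: "e dvd W"
  proof (rule dvd_of_coprime_multiples[OF c0])
    have "x0 * W = x * (x' * y0 + y' * x0) - x' * (x * y0 + y * x0)"
      by (simp add: W_def algebra_simps)
    then show "e dvd x0 * W" using B1 B2 by simp
    have "y0 * W = y' * (x * y0 + y * x0) - y * (x' * y0 + y' * x0)"
      by (simp add: W_def algebra_simps)
    then show "e dvd y0 * W" using B1 B2 by simp
  qed
  define g where "g = gcd d e"
  have gm: "g dvd m" using mde by (simp add: g_def)
  have "g dvd (x * y0 - y * x0) + (x * y0 + y * x0)"
    using A1 B1 unfolding g_def by (meson dvd_add dvd_trans gcd_dvd1 gcd_dvd2)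
  then have "g dvd 2 * x * y0" by (simp add: algebra_simps)
  moreover have "coprime g x" using coprime_sum_squares(1)[OF c1] gm n1 by simp
  moreover have "coprime g y0" using coprime_sum_squares(2)[OF c0] gm n0 by simp
  ultimately have "g dvd 2" by (simp add: coprime_dvd_mult_left_iff)
  moreover have "lcm d e dvd W" using dW eW by (rule lcm_least)
  ultimately have "g * lcm d e dvd 2 * W" by (rule mult_dvd_mono)
  moreover have "g * lcm d e = normalize m"
    unfolding g_def mde by (simp add: mult.commute abs_mult flip: normalize_mult)
  ultimately show ?thesis by (simp add: W_def)
qed

definition primitive_circle :: "nat \<Rightarrow> (int \<times> int) set" where
  "primitive_circle m = {(x, y). x\<^sup>2 + y\<^sup>2 = int m \<and> coprime x y}"

text \<open>
  Fix one primitive point and sort the others by the divisor of \<open>m\<close> that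
  \<open>same_gcd_dvd_cross\<close> attaches to them. Within a class, two points have a cross product \<open>W\<close> with
  \<open>m dvd 2 W\<close> and an inner product \<open>S\<close> with \<open>W^2 + S^2 = m^2\<close>. So relative to one point of the class,
  another one is determined by \<open>2 W / m\<close>, which lies between \<open>-2\<close> and \<open>2\<close>, and by the sign of \<open>S\<close>:
  at most \<open>15\<close> possibilities.
\<close>

lemma card_primitive_circle:
  assumes "m > 0" shows "card (primitive_circle m) \<le> 15 * divisor_count m"
proof (cases "primitive_circle m = {}")
  case False
  then obtain x0 y0 where p0: "x0\<^sup>2 + y0\<^sup>2 = int m" "coprime x0 y0"
    unfolding primitive_circle_def by auto
  define f where "f = (\<lambda>(x, y). nat (gcd (x * y0 - y * x0) (int m)))"
  have "card (primitive_circle m) \<le> card {d. d dvd m} * 15"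
  proof (rule card_le_fibers)
    show "finite {d. d dvd m}" using assms by simp
    show "f ` primitive_circle m \<subseteq> {d. d dvd m}"
    proof -
      have "nat (gcd a (int m)) dvd m" for a
      proof -
        have "int (nat (gcd a (int m))) dvd int m" by simp
        then show ?thesis using of_nat_dvd_iff by blast
      qed
      then show ?thesis by (auto simp: f_def)
    qed
    fix d assume "d \<in> {d. d dvd m}"
    show "card {p \<in> primitive_circle m. f p = d} \<le> 15"
    proof (cases "{p \<in> primitive_circle m. f p = d} = {}")
      case False
      then obtain x y where p: "x\<^sup>2 + y\<^sup>2 = int m" "coprime x y" "f (x, y) = d"
        unfolding primitive_circle_def by auto
      define W where "W = (\<lambda>(x', y'). x * y' - x' * y)"
      define S where "S = (\<lambda>(x', y'). x * x' + y * y')"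
      define h where "h = (\<lambda>p. ((2 * W p) div int m, sgn (S p)))"
      have WS: "(W q)\<^sup>2 + (S q)\<^sup>2 = (int m)\<^sup>2" and dv: "int m dvd 2 * W q"
        and cx: "int m * fst q = S q * x - W q * y" and cy: "int m * snd q = S q * y + W q * x"
        if q: "q \<in> primitive_circle m" "f q = d" for q
      proof -
        obtain x' y' where q': "q = (x', y')" "x'\<^sup>2 + y'\<^sup>2 = int m" "coprime x' y'"
          using q unfolding primitive_circle_def by auto
        have "(x * y' - x' * y)\<^sup>2 + (x * x' + y * y')\<^sup>2 = (x\<^sup>2 + y\<^sup>2) * (x'\<^sup>2 + y'\<^sup>2)" by algebra
        then show "(W q)\<^sup>2 + (S q)\<^sup>2 = (int m)\<^sup>2"
          using q' p by (simp add: W_def S_def power2_eq_square)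
        show "int m * fst q = S q * x - W q * y" "int m * snd q = S q * y + W q * x"
          unfolding p(1)[symmetric] q' W_def S_def
          by (simp_all add: algebra_simps power2_eq_square)
        have "f q = f (x, y)" using q p by simp
        then have "int (nat (gcd (x' * y0 - y' * x0) (int m))) = int (nat (gcd (x * y0 - y * x0) (int m)))"
          unfolding q' f_def by simp
        then have "gcd (x * y0 - y * x0) (int m) = gcd (x' * y0 - y' * x0) (int m)" by simp
        then show "int m dvd 2 * W q" unfolding W_def q'
          using same_gcd_dvd_cross[OF _ p0(1) p(1) q'(2) p0(2) p(2) q'(3)] assms by simp
      qed
      have "card {p \<in> primitive_circle m. f p = d} \<le> card ({-2..2} \<times> {-1..1::int} :: (int \<times> int) set)"
      proof (rule card_inj_on_le)
        show "h ` {p \<in> primitive_circle m. f p = d} \<subseteq> {-2..2} \<times> {-1..1}"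
        proof (rule image_subsetI)
          fix q assume "q \<in> {p \<in> primitive_circle m. f p = d}"
          then have q: "q \<in> primitive_circle m" "f q = d" by auto
          have "(W q)\<^sup>2 \<le> (int m)\<^sup>2" using WS[OF q] zero_le_power2[of "S q"] by linarith
          then have W: "\<bar>W q\<bar> \<le> int m" using abs_le_square_iff[of "W q" "int m"] by simp
          define k where "k = (2 * W q) div int m"
          have k: "2 * W q = int m * k" using dv[OF q] k_def by simp
          have "int m * \<bar>k\<bar> = \<bar>2 * W q\<bar>" unfolding k by (simp add: abs_mult)
          also have "\<dots> \<le> int m * 2" using W by simp
          finally have "\<bar>k\<bar> \<le> 2" using assms by simp
          then show "h q \<in> {-2..2} \<times> {-1..1}"
            unfolding h_def k_def[symmetric] by (auto simp: sgn_if)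
        qed
        show "inj_on h {p \<in> primitive_circle m. f p = d}"
        proof (rule inj_onI)
          fix q r assume "q \<in> {p \<in> primitive_circle m. f p = d}"
            "r \<in> {p \<in> primitive_circle m. f p = d}" and hh: "h q = h r"
          then have q: "q \<in> primitive_circle m" "f q = d"
            and r: "r \<in> primitive_circle m" "f r = d" by auto
          have "2 * W q = 2 * W r"
            using hh dv[OF q] dv[OF r] unfolding h_def by (metis dvd_div_mult_self prod.inject)
          then have W: "W q = W r" by simp
          then have "(S q)\<^sup>2 = (S r)\<^sup>2" using WS[OF q] WS[OF r] by simp
          then have "\<bar>S q\<bar> = \<bar>S r\<bar>" by (simp add: power2_eq_iff abs_eq_iff)
          moreover have "sgn (S q) = sgn (S r)" using hh by (simp add: h_def)
          ultimately have S: "S q = S r" by (metis sgn_mult_abs)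
          have "int m * fst q = int m * fst r" using cx[OF q] cx[OF r] W S by simp
          then have "fst q = fst r" using assms by simp
          moreover have "snd q = snd r"
          proof -
            have "int m * snd q = int m * snd r" using cy[OF q] cy[OF r] W S by simp
            then show ?thesis using assms by simp
          qed
          ultimately show "q = r" by (simp add: prod_eq_iff)
        qed
      qed simp
      then show ?thesis by simp
    next
      case True
      show ?thesis unfolding True by simp
    qed
  qed
  then show ?thesis by (simp add: divisor_count_def mult.commute)
qed simp

lemma card_lattice_circle:
  assumes "n > 0" shows "card (lattice_circle n) \<le> 15 * (divisor_count n)\<^sup>2"
proof -
  define f :: "int \<times> int \<Rightarrow> nat" where "f = (\<lambda>(x, y). nat (gcd x y))"
  have "card (lattice_circle n) \<le> card {d. d dvd n} * (15 * divisor_count n)"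
  proof (rule card_le_fibers)
    show fin: "finite {d. d dvd n}" using assms by simp
    have sq: "\<exists>m. n = (f p)\<^sup>2 * m \<and> (fst p div int (f p), snd p div int (f p)) \<in> primitive_circle m
        \<and> int (f p) dvd fst p \<and> int (f p) dvd snd p"
      if p: "p \<in> lattice_circle n" for p
    proof -
      obtain x y where xy: "p = (x, y)" "x\<^sup>2 + y\<^sup>2 = int n" using p by (auto simp: lattice_circle_def)
      define g where "g = gcd x y"
      have fg: "int (f p) = g" by (simp add: f_def xy g_def)
      have "g \<noteq> 0" using xy assms by (auto simp: g_def)
      then have g: "g > 0" by (simp add: g_def order_less_le)
      obtain a b where ab: "x = g * a" "y = g * b" unfolding g_def by (meson dvdE gcd_dvd1 gcd_dvd2)
      have cop: "coprime a b"
        using div_gcd_coprime[of x y] \<open>g \<noteq> 0\<close> ab unfolding g_def[symmetric]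
        by (metis mult_eq_0_iff nonzero_mult_div_cancel_left coprime_0_left_iff gcd_0_left g_def gcd_eq_0_iff)
      have "int n = g\<^sup>2 * (a\<^sup>2 + b\<^sup>2)" using xy(2) unfolding ab by (simp add: power_mult_distrib distrib_left)
      then have "int n = int ((f p)\<^sup>2 * nat (a\<^sup>2 + b\<^sup>2))" using fg by simp
      then have "n = (f p)\<^sup>2 * nat (a\<^sup>2 + b\<^sup>2)" using of_nat_eq_iff by blast
      moreover have "(a, b) \<in> primitive_circle (nat (a\<^sup>2 + b\<^sup>2))"
        using cop by (simp add: primitive_circle_def)
      moreover have "fst p div int (f p) = a" "snd p div int (f p) = b"
        using fg xy ab g by simp_all
      ultimately show ?thesis using fg xy ab by auto
    qed
    show "f ` lattice_circle n \<subseteq> {d. d dvd n}" using sq by fastforce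
    fix d assume d: "d \<in> {d. d dvd n}"
    show "card {p \<in> lattice_circle n. f p = d} \<le> 15 * divisor_count n"
    proof (cases "{p \<in> lattice_circle n. f p = d} = {}")
      case False
      then obtain p where "p \<in> lattice_circle n" "f p = d" by auto
      from sq[OF this(1)] obtain m where m: "n = d\<^sup>2 * m" unfolding \<open>f p = d\<close> by blast
      have d0: "d > 0" and m0: "m > 0" using m assms by (auto intro: gr0I)
      have "card {p \<in> lattice_circle n. f p = d} \<le> card (primitive_circle m)"
      proof (rule card_inj_on_le[of "\<lambda>p. (fst p div int d, snd p div int d)"])
        show "inj_on (\<lambda>p. (fst p div int d, snd p div int d)) {p \<in> lattice_circle n. f p = d}"
        proof (rule inj_onI)
          fix p q assume "p \<in> {p \<in> lattice_circle n. f p = d}" "q \<in> {p \<in> lattice_circle n. f p = d}"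
            and "(fst p div int d, snd p div int d) = (fst q div int d, snd q div int d)"
          then have p: "p \<in> lattice_circle n" "f p = d" and q: "q \<in> lattice_circle n" "f q = d"
            and e: "fst p div int d = fst q div int d" "snd p div int d = snd q div int d" by auto
          have "int d dvd fst p" "int d dvd snd p" "int d dvd fst q" "int d dvd snd q"
            using sq[OF p(1)] sq[OF q(1)] p q by auto
          then show "p = q" using e by (metis dvd_div_mult_self prod_eq_iff)
        qed
        show "(\<lambda>p. (fst p div int d, snd p div int d)) ` {p \<in> lattice_circle n. f p = d}
            \<subseteq> primitive_circle m"
        proof (rule image_subsetI)
          fix p assume "p \<in> {p \<in> lattice_circle n. f p = d}"
          then have p: "p \<in> lattice_circle n" "f p = d" by auto
          from sq[OF p(1)] obtain m' where m': "n = d\<^sup>2 * m'"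
            "(fst p div int d, snd p div int d) \<in> primitive_circle m'" unfolding p(2) by blast
          have "m' = m" using m m'(1) d0 by simp
          then show "(fst p div int d, snd p div int d) \<in> primitive_circle m" using m' by simp
        qed
        show "finite (primitive_circle m)"
          by (rule finite_subset[OF _ finite_lattice_circle[of m]])
            (auto simp: primitive_circle_def lattice_circle_def)
      qed
      also have "\<dots> \<le> 15 * divisor_count m" by (rule card_primitive_circle[OF m0])
      also have "divisor_count m \<le> divisor_count n" unfolding divisor_count_def
        by (rule card_mono[OF fin]) (auto simp: m)
      finally show ?thesis by simp
    next
      case True
      show ?thesis unfolding True by simp
    qed
  qed
  then show ?thesis by (simp add: divisor_count_def power2_eq_square mult_ac)
qed

definition lattice_vec :: "int \<times> int \<Rightarrow> real ^ 2" where
  "lattice_vec n = vector [of_int (fst n), of_int (snd n)]"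

lemma norm_lattice_vec: "norm (lattice_vec n) = sqrt ((of_int (fst n))\<^sup>2 + (of_int (snd n))\<^sup>2)"
  by (simp add: lattice_vec_def norm_vec_def L2_set_def sum_2)

lemma lattice_vec_diff: "lattice_vec (m - n) = lattice_vec m - lattice_vec n"
  by (simp add: lattice_vec_def vec_eq_iff forall_2)

lemma lattice_vec_eq_0_iff: "lattice_vec n = 0 \<longleftrightarrow> n = 0"
  by (auto simp: lattice_vec_def vec_eq_iff forall_2 prod_eq_iff)

lemma lattice_vec_dist_sq: "(norm (lattice_vec (n - m)))\<^sup>2 = of_int ((fst n - fst m)\<^sup>2 + (snd n - snd m)\<^sup>2)"
  by (simp add: norm_lattice_vec)

text \<open>
  A triangle with sides \<open>p, q, r\<close>, area \<open>T\<close> and circumradius \<open>R\<close> satisfies \<open>p q r = 4 T R\<close>. Twice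
  the area of a lattice triangle is a nonzero integer (a circle contains no three collinear points),
  so \<open>(p q r)^2 \<ge> 4 R^2\<close>.
\<close>

lemma three_points_on_circle:
  fixes a b c d e f :: int
  assumes "a\<^sup>2 + b\<^sup>2 = n" "c\<^sup>2 + d\<^sup>2 = n" "e\<^sup>2 + f\<^sup>2 = n"
    and "(a, b) \<noteq> (c, d)" "(a, b) \<noteq> (e, f)" "(c, d) \<noteq> (e, f)"
  shows "4 * n \<le> ((a - c)\<^sup>2 + (b - d)\<^sup>2) * ((a - e)\<^sup>2 + (b - f)\<^sup>2) * ((c - e)\<^sup>2 + (d - f)\<^sup>2)"
proof -
  have id: "4 * n * ((a - c) * (b - f) - (b - d) * (a - e))\<^sup>2
    = ((a - c)\<^sup>2 + (b - d)\<^sup>2) * ((a - e)\<^sup>2 + (b - f)\<^sup>2) * ((c - e)\<^sup>2 + (d - f)\<^sup>2)" (is "_ * ?D\<^sup>2 = ?R")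
  proof -
    define u v s t where "u = c - a" "v = d - b" "s = e - a" "t = f - b"
    have U: "2 * (a * u + b * v) = - (u\<^sup>2 + v\<^sup>2)" and V: "2 * (a * s + b * t) = - (s\<^sup>2 + t\<^sup>2)"
      using assms(1-3) unfolding u_v_s_t_def by (simp_all add: power2_eq_square algebra_simps)
    have "4 * (a\<^sup>2 + b\<^sup>2) * (u * t - v * s)\<^sup>2
      = (2 * (a * u + b * v))\<^sup>2 * (s\<^sup>2 + t\<^sup>2) + (2 * (a * s + b * t))\<^sup>2 * (u\<^sup>2 + v\<^sup>2)
        - 2 * (2 * (a * u + b * v)) * (2 * (a * s + b * t)) * (u * s + v * t)" by algebra
    also have "\<dots> = (u\<^sup>2 + v\<^sup>2) * (s\<^sup>2 + t\<^sup>2) * ((u - s)\<^sup>2 + (v - t)\<^sup>2)"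
      unfolding U V by algebra
    finally show ?thesis unfolding assms(1) u_v_s_t_def by algebra
  qed
  have pos: "x\<^sup>2 + y\<^sup>2 > 0" if "(x, y) \<noteq> (0, 0)" for x y :: int
    using that by (simp add: sum_power2_gt_zero_iff)
  have "?R > 0" using assms(4-6) by (intro mult_pos_pos pos) auto
  then have "?D \<noteq> 0" using id by auto
  then have "?D\<^sup>2 \<ge> 1" by (metis linorder_not_less power2_less_0 zero_less_power2 zle_add1_eq_le add_0 int_one_le_iff_zero_less)
  moreover have "n \<ge> 0" using assms(1) by (metis sum_power2_ge_zero)
  ultimately have "4 * n * 1 \<le> 4 * n * ?D\<^sup>2" by (intro mult_left_mono) auto
  then show ?thesis using id by simp
qed

text \<open>
  Two neighbours of \<open>n\<close> within \<open>D / 2\<close> would form with \<open>n\<close> a triangle all of whose sides are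
  shorter than \<open>D\<close>, against Jarnik's inequality \<open>three_points_on_circle\<close>. So closeness at the
  scale of the cube root of the radius is at most a matching.
\<close>

lemma at_most_one_close_lattice_point:
  assumes D: "0 \<le> D" "D ^ 6 \<le> 4 * real N" and n: "n \<in> lattice_circle N"
  shows "card {m \<in> lattice_circle N. m \<noteq> n \<and> norm (lattice_vec (n - m)) < D / 2} \<le> 1"
proof (rule card_le_Suc0_iff_eq[THEN iffD2, folded One_nat_def])
  show "finite {m \<in> lattice_circle N. m \<noteq> n \<and> norm (lattice_vec (n - m)) < D / 2}"
    using finite_lattice_circle by simp
  show "\<forall>m\<in>{m \<in> lattice_circle N. m \<noteq> n \<and> norm (lattice_vec (n - m)) < D / 2}.
    \<forall>p\<in>{m \<in> lattice_circle N. m \<noteq> n \<and> norm (lattice_vec (n - m)) < D / 2}. m = p"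
  proof (intro ballI, rule ccontr)
    fix m p assume "m \<in> {m \<in> lattice_circle N. m \<noteq> n \<and> norm (lattice_vec (n - m)) < D / 2}"
      "p \<in> {m \<in> lattice_circle N. m \<noteq> n \<and> norm (lattice_vec (n - m)) < D / 2}" and ne: "m \<noteq> p"
    then have m: "m \<in> lattice_circle N" "m \<noteq> n" "norm (lattice_vec (n - m)) < D / 2"
      and p: "p \<in> lattice_circle N" "p \<noteq> n" "norm (lattice_vec (n - p)) < D / 2" by auto
    have "lattice_vec (m - p) = lattice_vec (n - p) - lattice_vec (n - m)" by (simp add: lattice_vec_diff)
    then have mp: "norm (lattice_vec (m - p)) < D"
      using norm_triangle_ineq4[of "lattice_vec (n - p)" "lattice_vec (n - m)"] m p by simp
    have "4 * int N \<le> ((fst n - fst m)\<^sup>2 + (snd n - snd m)\<^sup>2) * ((fst n - fst p)\<^sup>2 + (snd n - snd p)\<^sup>2)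
        * ((fst m - fst p)\<^sup>2 + (snd m - snd p)\<^sup>2)"
      by (rule three_points_on_circle)
        (use n m p ne in \<open>auto simp: lattice_circle_def case_prod_beta prod_eq_iff\<close>)
    then have "real_of_int (4 * int N) \<le> of_int (((fst n - fst m)\<^sup>2 + (snd n - snd m)\<^sup>2) * ((fst n - fst p)\<^sup>2 + (snd n - snd p)\<^sup>2)
        * ((fst m - fst p)\<^sup>2 + (snd m - snd p)\<^sup>2))" by (simp only: of_int_le_iff)
    also have "\<dots> = (norm (lattice_vec (n - m)) * norm (lattice_vec (n - p)) * norm (lattice_vec (m - p)))\<^sup>2"
      by (simp only: of_int_mult lattice_vec_dist_sq[symmetric] power_mult_distrib)
    also have "\<dots> < (D ^ 3)\<^sup>2"
    proof (rule power_strict_mono)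
      have "norm (lattice_vec (n - m)) * norm (lattice_vec (n - p)) \<le> D / 2 * (D / 2)"
        using m p D by (intro mult_mono) auto
      also have "\<dots> \<le> D * D" using D by (intro mult_mono) auto
      finally have "norm (lattice_vec (n - m)) * norm (lattice_vec (n - p)) \<le> D * D" .
      moreover have "0 < norm (lattice_vec (n - m)) * norm (lattice_vec (n - p))" using m p by (simp add: lattice_vec_eq_0_iff)
      ultimately show "norm (lattice_vec (n - m)) * norm (lattice_vec (n - p)) * norm (lattice_vec (m - p)) < D ^ 3"
        using mp by (simp add: power3_eq_cube mult_le_less_imp_less)
    qed auto
    also have "(D ^ 3)\<^sup>2 = D ^ 6" by simp
    finally show False using D by simp
  qed
qed

text \<open>
  The radius is \<open>lam\<close>. Points that are not close are at distance at least of order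
  \<open>lam powr (1/3)\<close>, where the curve transform is of size \<open>lam powr (-1/6)\<close>. The divisor bound with
  exponent \<open>1/48\<close> for \<open>N = lam^2\<close>, squared, gives only \<open>O(lam powr (1/12))\<close> lattice points, so the
  product tends to zero.
\<close>

lemma few_lattice_points_eventually:
  fixes C \<delta> :: real
  assumes C: "C > 0" and \<delta>: "\<delta> > 0"
  shows "\<exists>\<Lambda>\<ge>4. \<forall>lam N. lam \<ge> \<Lambda> \<longrightarrow> lam\<^sup>2 = real N \<longrightarrow>
    real (card (lattice_circle N)) * (C / sqrt ((2 * lam) powr (1/3) / 2)) \<le> \<delta>"
proof -
  obtain B where B: "B > 0" "\<And>n. n > 0 \<Longrightarrow> real (divisor_count n) \<le> B * real n powr (1/48)"
    using divisor_count_le_powr[of "1/48"] by auto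
  define K where "K = 15 * B\<^sup>2 * C * sqrt 2"
  have "((\<lambda>lam. K * lam powr (-1/12)) \<longlongrightarrow> K * 0) at_top"
    by (intro tendsto_intros tendsto_neg_powr filterlim_ident) auto
  then have "eventually (\<lambda>lam. K * lam powr (-1/12) < \<delta>) at_top"
    using \<delta> by (intro order_tendstoD(2)) auto
  then obtain \<Lambda>0 where \<Lambda>0: "\<And>lam. lam \<ge> \<Lambda>0 \<Longrightarrow> K * lam powr (-1/12) < \<delta>"
    unfolding eventually_at_top_linorder by blast
  have "real (card (lattice_circle N)) * (C / sqrt ((2 * lam) powr (1/3) / 2)) \<le> \<delta>"
    if lam: "lam \<ge> max 4 \<Lambda>0" and N: "lam\<^sup>2 = real N" for lam N
  proof -
    have l4: "lam \<ge> 4" using lam by simp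
    have N0: "N > 0" using N l4 by (cases N) auto
    have "real N powr (1/48) = lam powr (1/24)"
    proof -
      have "real N = lam powr 2" using N l4 by simp
      then show ?thesis by (simp add: powr_powr)
    qed
    then have "real (divisor_count N) \<le> B * lam powr (1/24)" using B(2)[OF N0] by simp
    then have "(real (divisor_count N))\<^sup>2 \<le> (B * lam powr (1/24))\<^sup>2" by (intro power_mono) auto
    also have "\<dots> = B\<^sup>2 * lam powr (1/12)"
      using l4 by (simp add: power_mult_distrib powr_power)
    finally have "15 * (real (divisor_count N))\<^sup>2 \<le> 15 * (B\<^sup>2 * lam powr (1/12))" by simp
    moreover have "real (card (lattice_circle N)) \<le> 15 * (real (divisor_count N))\<^sup>2"
      using card_lattice_circle[OF N0] by (metis of_nat_le_iff of_nat_mult of_nat_numeral of_nat_power)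
    ultimately have card: "real (card (lattice_circle N)) \<le> 15 * B\<^sup>2 * lam powr (1/12)" by simp
    have sq: "sqrt ((2 * lam) powr (1/3) / 2) \<ge> lam powr (1/6) / sqrt 2"
    proof -
      have "lam powr (1/6) = sqrt (lam powr (1/3))"
        by (simp add: powr_half_sqrt[symmetric] powr_powr)
      also have "\<dots> \<le> sqrt ((2 * lam) powr (1/3))" using l4 by (simp add: powr_mono2)
      finally show ?thesis by (simp add: real_sqrt_divide divide_right_mono)
    qed
    have "C / sqrt ((2 * lam) powr (1/3) / 2) \<le> C / (lam powr (1/6) / sqrt 2)"
      using C l4 by (intro divide_left_mono sq mult_pos_pos) auto
    also have "\<dots> = C * sqrt 2 * lam powr (-1/6)" using l4 by (simp add: powr_minus_divide)
    finally have "real (card (lattice_circle N)) * (C / sqrt ((2 * lam) powr (1/3) / 2))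
        \<le> (15 * B\<^sup>2 * lam powr (1/12)) * (C * sqrt 2 * lam powr (-1/6))"
      using card C l4 by (intro mult_mono) auto
    also have "\<dots> = K * (lam powr (1/12) * lam powr (-1/6))" by (simp add: K_def)
    also have "lam powr (1/12) * lam powr (-1/6) = lam powr (-1/12)"
      by (simp add: powr_add[symmetric])
    finally show ?thesis using \<Lambda>0[of lam] lam by simp
  qed
  then show ?thesis by (intro exI[of _ "max 4 \<Lambda>0"]) auto
qed

section \<open>Oscillatory integrals along curved arcs\<close>

lemma arctan_weight_deriv:
  fixes \<psi> \<psi>1 :: "real \<Rightarrow> real"
  assumes "(\<psi> has_real_derivative \<psi>1 t) (at t within S)"
    and "(\<psi>1 has_real_derivative p2) (at t within S)" and th: "\<theta> > 0"
  shows "((\<lambda>t. \<psi>1 t * arctan (\<psi> t / \<theta>) / \<theta>) has_real_derivative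
     (p2 * arctan (\<psi> t / \<theta>) / \<theta> + (\<psi>1 t)\<^sup>2 / ((\<psi> t)\<^sup>2 + \<theta>\<^sup>2))) (at t within S)"
proof -
  have "0 < (\<psi> t)\<^sup>2 + \<theta>\<^sup>2" using th by (simp add: add_nonneg_pos)
  then have e: "p2 * arctan (\<psi> t / \<theta>) / \<theta> + (\<psi>1 t)\<^sup>2 / ((\<psi> t)\<^sup>2 + \<theta>\<^sup>2)
      = (p2 * arctan (\<psi> t / \<theta>) + \<psi>1 t * ((\<psi>1 t / \<theta>) * inverse (1 + (\<psi> t / \<theta>)\<^sup>2))) / \<theta>"
    using th by (simp add: field_simps power2_eq_square)
  have "((\<lambda>t. arctan (\<psi> t / \<theta>)) has_real_derivative inverse (1 + (\<psi> t / \<theta>)\<^sup>2) * (\<psi>1 t / \<theta>))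
      (at t within S)"
    by (rule DERIV_chain2[OF DERIV_arctan DERIV_cdivide[OF assms(1)]])
  from DERIV_cdivide[OF DERIV_mult[OF assms(2) this], of \<theta>]
  show ?thesis unfolding e by (simp only: mult_ac)
qed

text \<open>
  Where \<open>\<psi>\<close> is small its derivative is not, so \<open>\<psi>\<close> crosses zero at positive speed and the integral
  should have size \<open>1 / \<theta>\<close>. No subdivision of the interval is needed to see this: the function
  \<open>H = \<psi>' arctan (\<psi> / \<theta>) / \<theta>\<close> is \<open>O(1 / \<theta>)\<close>, and its derivative is \<open>\<psi>'^2 / (\<psi>^2 + \<theta>^2)\<close>
  up to a term \<open>O(1 / \<theta>)\<close>. By hypothesis this main term is at least
  \<open>k / (\<psi>^2 + \<theta>^2) - k\<close>, and integrating \<open>H'\<close> gives the bound.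
\<close>

lemma integral_inverse_quadratic_le:
  fixes \<psi> \<psi>1 \<psi>2 :: "real \<Rightarrow> real"
  assumes L: "L > 0"
    and d1: "\<And>t. t \<in> {0..L} \<Longrightarrow> (\<psi> has_real_derivative \<psi>1 t) (at t within {0..L})"
    and d2: "\<And>t. t \<in> {0..L} \<Longrightarrow> (\<psi>1 has_real_derivative \<psi>2 t) (at t within {0..L})"
    and c2: "continuous_on {0..L} \<psi>2"
    and k: "k > 0" and nd: "\<And>t. t \<in> {0..L} \<Longrightarrow> (\<psi>1 t)\<^sup>2 \<ge> k * (1 - (\<psi> t)\<^sup>2)"
    and b1: "\<And>t. t \<in> {0..L} \<Longrightarrow> \<bar>\<psi>1 t\<bar> \<le> M" and b2: "\<And>t. t \<in> {0..L} \<Longrightarrow> \<bar>\<psi>2 t\<bar> \<le> M"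
    and th: "0 < \<theta>" "\<theta> \<le> 1"
  shows "integral {0..L} (\<lambda>t. 1 / ((\<psi> t)\<^sup>2 + \<theta>\<^sup>2)) \<le> ((4 * M + L * (k + 2 * M)) / k) / \<theta>"
proof -
  define H where "H t = \<psi>1 t * arctan (\<psi> t / \<theta>) / \<theta>" for t
  define H' where "H' t = \<psi>2 t * arctan (\<psi> t / \<theta>) / \<theta> + (\<psi>1 t)\<^sup>2 / ((\<psi> t)\<^sup>2 + \<theta>\<^sup>2)" for t
  have dH: "(H has_real_derivative H' t) (at t within {0..L})" if "t \<in> {0..L}" for t
    unfolding H_def H'_def by (rule arctan_weight_deriv[OF d1[OF that] d2[OF that] th(1)])
  have M0: "M \<ge> 0" using b1[of 0] L by auto
  have at2: "\<bar>arctan x\<bar> \<le> 2" for x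
    using arctan_bounded[of x] pi_less_4 by auto
  have cont: "continuous_on {0..L} \<psi>" "continuous_on {0..L} \<psi>1"
    using d1 d2 by (meson DERIV_continuous continuous_on_eq_continuous_within)+
  have pos: "(\<psi> t)\<^sup>2 + \<theta>\<^sup>2 > 0" for t using th by (simp add: add_nonneg_pos)
  then have nz: "(\<psi> t)\<^sup>2 + \<theta>\<^sup>2 \<noteq> 0" for t by (metis less_irrefl)
  have contH': "continuous_on {0..L} H'"
    unfolding H'_def using th nz by (intro continuous_intros cont c2) auto
  have iH: "(H' has_integral (H L - H 0)) {0..L}"
    using L dH by (intro fundamental_theorem_of_calculus)
      (auto simp: has_real_derivative_iff_has_vector_derivative)
  have bH: "\<bar>H t\<bar> \<le> 2 * M / \<theta>" if "t \<in> {0..L}" for t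
  proof -
    have "\<bar>\<psi>1 t * arctan (\<psi> t / \<theta>)\<bar> \<le> M * 2"
      unfolding abs_mult using b1[OF that] at2 M0 by (intro mult_mono) auto
    then show ?thesis unfolding H_def using th by (simp add: abs_divide divide_right_mono mult.commute)
  qed
  have ptw: "k * (1 / ((\<psi> t)\<^sup>2 + \<theta>\<^sup>2)) \<le> H' t + (k + 2 * M / \<theta>)" if t: "t \<in> {0..L}" for t
  proof -
    have "\<bar>\<psi>2 t * arctan (\<psi> t / \<theta>)\<bar> \<le> M * 2"
      unfolding abs_mult using b2[OF t] at2 M0 by (intro mult_mono) auto
    then have "\<bar>\<psi>2 t * arctan (\<psi> t / \<theta>) / \<theta>\<bar> \<le> 2 * M / \<theta>"
      using th by (simp add: abs_divide divide_right_mono mult.commute)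
    moreover have "k * (1 / ((\<psi> t)\<^sup>2 + \<theta>\<^sup>2)) - k \<le> (\<psi>1 t)\<^sup>2 / ((\<psi> t)\<^sup>2 + \<theta>\<^sup>2)"
    proof -
      have "k * (1 / ((\<psi> t)\<^sup>2 + \<theta>\<^sup>2)) - k = (k * (1 - (\<psi> t)\<^sup>2) - k * \<theta>\<^sup>2) / ((\<psi> t)\<^sup>2 + \<theta>\<^sup>2)"
        using nz[of t] by (simp add: field_simps)
      also have "\<dots> \<le> (\<psi>1 t)\<^sup>2 / ((\<psi> t)\<^sup>2 + \<theta>\<^sup>2)"
      proof (intro divide_right_mono)
        have "k * \<theta>\<^sup>2 \<ge> 0" using k by simp
        then show "k * (1 - (\<psi> t)\<^sup>2) - k * \<theta>\<^sup>2 \<le> (\<psi>1 t)\<^sup>2" using nd[OF t] by linarith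
      qed (use pos[of t] in simp)
      finally show ?thesis .
    qed
    ultimately show ?thesis unfolding H'_def by linarith
  qed
  have "k * integral {0..L} (\<lambda>t. 1 / ((\<psi> t)\<^sup>2 + \<theta>\<^sup>2)) = integral {0..L} (\<lambda>t. k * (1 / ((\<psi> t)\<^sup>2 + \<theta>\<^sup>2)))"
    by (rule integral_mult_right[symmetric])
  also have "\<dots> \<le> integral {0..L} (\<lambda>t. H' t + (k + 2 * M / \<theta>))"
    using ptw nz by (intro integral_le integrable_continuous_real continuous_intros cont contH') auto
  also have "\<dots> = (H L - H 0) + L * (k + 2 * M / \<theta>)"
    using L by (intro integral_unique)
      (use has_integral_add[OF iH has_integral_const_real[of "k + 2 * M / \<theta>" 0 L]] in auto)
  also have "\<dots> \<le> 4 * M / \<theta> + L * ((k + 2 * M) / \<theta>)"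
  proof -
    have "k \<le> k / \<theta>" using th k by (simp add: field_simps)
    then have "L * (k + 2 * M / \<theta>) \<le> L * ((k + 2 * M) / \<theta>)"
      using L by (intro mult_left_mono) (auto simp: add_divide_distrib)
    then show ?thesis using bH[of L] bH[of 0] L by auto
  qed
  also have "\<dots> = (4 * M + L * (k + 2 * M)) / \<theta>"
    by (simp only: add_divide_distrib[of "4 * M"] times_divide_eq_right)
  finally show ?thesis using k th by (simp add: field_simps)
qed

lemma has_vector_derivative_of_real:
  assumes "(f has_real_derivative f') (at t within S)"
  shows "((\<lambda>t. complex_of_real (f t)) has_vector_derivative complex_of_real f') (at t within S)"
  using bounded_linear.has_vector_derivative[OF bounded_linear_of_real] assms
  by (simp add: has_real_derivative_iff_has_vector_derivative)

lemma has_vector_derivative_cis: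
  assumes "(f has_real_derivative f') (at t within S)"
  shows "((\<lambda>t. cis (f t)) has_vector_derivative \<i> * of_real f' * cis (f t)) (at t within S)"
proof -
  have "((\<lambda>t. \<i> * complex_of_real (f t)) has_vector_derivative \<i> * of_real f') (at t within S)"
    by (intro has_vector_derivative_mult_right has_vector_derivative_of_real assms)
  from field_vector_diff_chain_within[OF this DERIV_subset[OF DERIV_exp subset_UNIV]]
  show ?thesis by (simp add: o_def cis_conv_exp)
qed

text \<open>
  One integration by parts, with the factor \<open>1 / \<phi>'\<close> regularized to \<open>\<phi>' / (\<phi>'^2 + \<eta>^2)\<close> so
  that stationary points do no harm. The regularized boundary terms are at most \<open>1 / \<eta>\<close>, and the
  error \<open>E\<close> of the regularization is dominated by \<open>(\<eta>^2 + K) / (\<phi>'^2 + \<eta>^2)\<close>.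
\<close>

lemma oscillatory_integral_le:
  fixes \<phi> \<phi>1 \<phi>2 :: "real \<Rightarrow> real"
  assumes L: "L > 0"
    and d1: "\<And>t. t \<in> {0..L} \<Longrightarrow> (\<phi> has_real_derivative \<phi>1 t) (at t within {0..L})"
    and d2: "\<And>t. t \<in> {0..L} \<Longrightarrow> (\<phi>1 has_real_derivative \<phi>2 t) (at t within {0..L})"
    and c2: "continuous_on {0..L} \<phi>2"
    and b2: "\<And>t. t \<in> {0..L} \<Longrightarrow> \<bar>\<phi>2 t\<bar> \<le> K"
    and eta: "\<eta> > 0"
  shows "norm (integral {0..L} (\<lambda>t. cis (\<phi> t))) \<le>
     2 / \<eta> + (\<eta>\<^sup>2 + K) * integral {0..L} (\<lambda>t. 1 / ((\<phi>1 t)\<^sup>2 + \<eta>\<^sup>2))"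
proof -
  define q where "q t = (\<phi>1 t)\<^sup>2 + \<eta>\<^sup>2" for t
  \<comment> \<open>The derivative of \<open>B\<close> is \<open>cis \<phi>\<close> up to the error \<open>E\<close>, which is small where \<open>\<phi>1\<close> is large.\<close>
  define B where "B t = - \<i> * (of_real (\<phi>1 t / q t) * cis (\<phi> t))" for t
  define E where "E t = of_real (\<eta>\<^sup>2 / q t) + \<i> * of_real (\<phi>2 t * (\<eta>\<^sup>2 - (\<phi>1 t)\<^sup>2) / (q t)\<^sup>2)" for t
  have pos: "q t > 0" for t unfolding q_def using eta by (simp add: add_nonneg_pos)
  then have nz: "q t \<noteq> 0" for t by (metis less_irrefl)
  have K0: "K \<ge> 0" using b2[of 0] L by auto
  have cont: "continuous_on {0..L} \<phi>" "continuous_on {0..L} \<phi>1"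
    using d1 d2 by (meson DERIV_continuous continuous_on_eq_continuous_within)+
  have contq: "continuous_on {0..L} q" unfolding q_def by (intro continuous_intros cont)
  have dB: "(B has_vector_derivative (cis (\<phi> t) - E t * cis (\<phi> t))) (at t within {0..L})"
    if t: "t \<in> {0..L}" for t
  proof -
    have r: "((\<lambda>t. \<phi>1 t / q t) has_real_derivative \<phi>2 t * (\<eta>\<^sup>2 - (\<phi>1 t)\<^sup>2) / (q t)\<^sup>2) (at t within {0..L})"
    proof -
      have "(q has_real_derivative 2 * \<phi>1 t * \<phi>2 t) (at t within {0..L})"
        using DERIV_add[OF DERIV_mult[OF d2[OF t] d2[OF t]] DERIV_const[of "\<eta>\<^sup>2"]]
        by (simp add: q_def[abs_def] power2_eq_square mult_ac)
      from DERIV_divide[OF d2[OF t] this nz]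
      have "((\<lambda>t. \<phi>1 t / q t) has_real_derivative
        (\<phi>2 t * q t - \<phi>1 t * (2 * \<phi>1 t * \<phi>2 t)) / (q t * q t)) (at t within {0..L})" .
      moreover have "\<phi>2 t * q t - \<phi>1 t * (2 * \<phi>1 t * \<phi>2 t) = \<phi>2 t * (\<eta>\<^sup>2 - (\<phi>1 t)\<^sup>2)"
        by (simp add: q_def power2_eq_square algebra_simps)
      ultimately show ?thesis by (simp add: power2_eq_square)
    qed
    have c: "((\<lambda>t. cis (\<phi> t)) has_vector_derivative (\<i> * of_real (\<phi>1 t) * cis (\<phi> t))) (at t within {0..L})"
      by (rule has_vector_derivative_cis[OF d1[OF t]])
    have "(B has_vector_derivative - \<i> * (of_real (\<phi>1 t / q t) * (\<i> * of_real (\<phi>1 t) * cis (\<phi> t))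
        + of_real (\<phi>2 t * (\<eta>\<^sup>2 - (\<phi>1 t)\<^sup>2) / (q t)\<^sup>2) * cis (\<phi> t))) (at t within {0..L})"
      unfolding B_def
      by (intro has_vector_derivative_mult_right has_vector_derivative_mult c
          has_vector_derivative_of_real r)
    moreover have "- \<i> * (of_real (\<phi>1 t / q t) * (\<i> * of_real (\<phi>1 t) * cis (\<phi> t))
        + of_real (\<phi>2 t * (\<eta>\<^sup>2 - (\<phi>1 t)\<^sup>2) / (q t)\<^sup>2) * cis (\<phi> t)) = cis (\<phi> t) - E t * cis (\<phi> t)"
    proof -
      have "\<eta>\<^sup>2 / q t = 1 - (\<phi>1 t / q t) * \<phi>1 t"
        using nz[of t] by (simp add: field_simps) (simp add: q_def power2_eq_square)
      then have "(of_real (\<eta>\<^sup>2 / q t) :: complex) = 1 - of_real (\<phi>1 t / q t) * of_real (\<phi>1 t)"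
        by (metis of_real_1 of_real_diff of_real_mult)
      moreover have "- \<i> * (p * (\<i> * s * c) + d * c) = c - (1 - p * s + \<i> * d) * c" for p s c d
        by (simp add: algebra_simps)
      ultimately show ?thesis unfolding E_def by presburger
    qed
    ultimately show ?thesis by simp
  qed
  have contE: "continuous_on {0..L} (\<lambda>t. E t * cis (\<phi> t))"
    unfolding E_def using nz by (intro continuous_intros cont contq c2) auto
  have iB: "((\<lambda>t. cis (\<phi> t) - E t * cis (\<phi> t)) has_integral (B L - B 0)) {0..L}"
    using L dB by (intro fundamental_theorem_of_calculus) auto
  have "integral {0..L} (\<lambda>t. cis (\<phi> t)) = (B L - B 0) + integral {0..L} (\<lambda>t. E t * cis (\<phi> t))"
    using has_integral_add[OF iB integrable_integral[OF integrable_continuous_real[OF contE]]]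
    by (simp add: integral_unique)
  also have "norm \<dots> \<le> norm (B L) + norm (B 0) + norm (integral {0..L} (\<lambda>t. E t * cis (\<phi> t)))"
    by (meson add_mono norm_triangle_ineq norm_triangle_ineq4 order_refl order_trans)
  also have "norm (integral {0..L} (\<lambda>t. E t * cis (\<phi> t))) \<le> integral {0..L} (\<lambda>t. (\<eta>\<^sup>2 + K) * (1 / q t))"
  proof (rule integral_norm_bound_integral)
    show "(\<lambda>t. (\<eta>\<^sup>2 + K) * (1 / q t)) integrable_on {0..L}"
      using nz by (intro integrable_continuous_real continuous_intros contq) auto
    show "norm (E t * cis (\<phi> t)) \<le> (\<eta>\<^sup>2 + K) * (1 / q t)" if t: "t \<in> {0..L}" for t
    proof -
      have "\<bar>\<phi>2 t * (\<eta>\<^sup>2 - (\<phi>1 t)\<^sup>2)\<bar> \<le> K * q t"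
        unfolding abs_mult using b2[OF t] K0 by (intro mult_mono) (auto simp: q_def abs_le_iff)
      then have "\<bar>\<phi>2 t * (\<eta>\<^sup>2 - (\<phi>1 t)\<^sup>2)\<bar> / (q t)\<^sup>2 \<le> K * q t / (q t)\<^sup>2"
        by (intro divide_right_mono) auto
      also have "\<dots> = K / q t" using nz[of t] by (simp add: power2_eq_square)
      finally have 1: "\<bar>\<phi>2 t * (\<eta>\<^sup>2 - (\<phi>1 t)\<^sup>2) / (q t)\<^sup>2\<bar> \<le> K / q t" by (simp add: abs_divide)
      have "norm (E t) \<le> \<bar>\<eta>\<^sup>2 / q t\<bar> + \<bar>\<phi>2 t * (\<eta>\<^sup>2 - (\<phi>1 t)\<^sup>2) / (q t)\<^sup>2\<bar>"
        unfolding E_def by (rule order_trans[OF norm_triangle_ineq]) (simp only: norm_mult norm_of_real norm_ii mult_1 order_refl)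
      also have "\<dots> \<le> \<eta>\<^sup>2 / q t + K / q t" using 1 pos[of t] by (simp add: abs_divide)
      finally show ?thesis by (simp add: norm_mult add_divide_distrib)
    qed
  qed (rule integrable_continuous_real[OF contE])
  finally have fin: "norm (integral {0..L} (\<lambda>t. cis (\<phi> t))) \<le>
    norm (B L) + norm (B 0) + integral {0..L} (\<lambda>t. (\<eta>\<^sup>2 + K) * (1 / q t))" by simp
  have "norm (B t) \<le> 1 / \<eta>" if "t \<in> {0..L}" for t
  proof -
    have "2 * \<eta> * \<bar>\<phi>1 t\<bar> \<le> q t"
      using sum_squares_bound[of \<eta> "\<bar>\<phi>1 t\<bar>"] by (simp add: q_def)
    moreover have "\<eta> * \<bar>\<phi>1 t\<bar> \<ge> 0" using eta by simp
    ultimately have "\<eta> * \<bar>\<phi>1 t\<bar> \<le> q t" by linarith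
    then have "\<bar>\<phi>1 t\<bar> / q t \<le> 1 / \<eta>" using pos[of t] eta by (simp add: field_simps)
    then show ?thesis unfolding B_def using pos[of t] by (simp add: norm_mult norm_divide)
  qed
  from this[of L] this[of 0] have "norm (B L) + norm (B 0) \<le> 2 / \<eta>" using L by simp
  moreover have "integral {0..L} (\<lambda>t. (\<eta>\<^sup>2 + K) * (1 / q t)) = (\<eta>\<^sup>2 + K) * integral {0..L} (\<lambda>t. 1 / q t)"
    by (rule integral_mult_right)
  ultimately show ?thesis using fin unfolding q_def by linarith
qed

text \<open>
  In the plane, \<open>N / norm N\<close> completes \<open>T\<close> to an orthonormal basis, so this is the theorem of
  Pythagoras for \<open>u\<close>; it also covers \<open>N = 0\<close>.
\<close>

lemma inner_square_orthogonal_plane: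
  fixes u T N :: "real ^ 2"
  assumes "norm T = 1" "T \<bullet> N = 0"
  shows "(u \<bullet> N)\<^sup>2 = (norm N)\<^sup>2 * ((norm u)\<^sup>2 - (u \<bullet> T)\<^sup>2)"
proof -
  define a b c d p q where "a = T $ 1" "b = T $ 2" "c = N $ 1" "d = N $ 2" "p = u $ 1" "q = u $ 2"
  note defs = this
  have 1: "a\<^sup>2 + b\<^sup>2 = 1" using assms(1)
    unfolding norm_eq_1 by (simp add: defs inner_vec_def sum_2 power2_eq_square)
  have 2: "a * c + b * d = 0" using assms(2) by (simp add: defs inner_vec_def sum_2)
  define s where "s = a * d - b * c"
  have "c = (a\<^sup>2 + b\<^sup>2) * c" "d = (a\<^sup>2 + b\<^sup>2) * d" using 1 by auto
  then have cd: "c = - b * s" "d = a * s" using 2 unfolding s_def by algebra+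
  have "(p * c + q * d)\<^sup>2 = s\<^sup>2 * (q * a - p * b)\<^sup>2" unfolding cd by algebra
  also have "(q * a - p * b)\<^sup>2 = (p\<^sup>2 + q\<^sup>2) * (a\<^sup>2 + b\<^sup>2) - (p * a + q * b)\<^sup>2" by algebra
  also have "\<dots> = (p\<^sup>2 + q\<^sup>2) - (p * a + q * b)\<^sup>2" using 1 by simp
  also have "s\<^sup>2 = c\<^sup>2 + d\<^sup>2"
  proof -
    have "c\<^sup>2 + d\<^sup>2 = (a\<^sup>2 + b\<^sup>2) * s\<^sup>2" unfolding cd by algebra
    then show ?thesis using 1 by simp
  qed
  finally show ?thesis
    unfolding power2_norm_eq_inner by (simp add: defs inner_vec_def sum_2 power2_eq_square)
qed

lemma derivative_within_Icc_unique:
  assumes "0 < L" "t \<in> {0..L}"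
    and "(f has_vector_derivative a) (at t within {0..L})"
    and "(f has_vector_derivative b) (at t within {0..L})"
  shows "a = b"
  using vector_derivative_unique_within_closed_interval[of 0 L t f a b] assms by simp

lemma smooth_arclength_curve_frame:
  assumes "smooth_arclength_curve L \<gamma>"
  obtains T T1 T2 where "0 < L"
    "\<And>t. t \<in> {0..L} \<Longrightarrow> (\<gamma> has_vector_derivative T t) (at t within {0..L})"
    "\<And>t. t \<in> {0..L} \<Longrightarrow> (T has_vector_derivative T1 t) (at t within {0..L})"
    "\<And>t. t \<in> {0..L} \<Longrightarrow> (T1 has_vector_derivative T2 t) (at t within {0..L})"
    "continuous_on {0..L} T2"
    "\<And>t. t \<in> {0..L} \<Longrightarrow> norm (T t) = 1"
    "\<And>t. t \<in> {0..L} \<Longrightarrow> T t \<bullet> T1 t = 0"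
    "\<And>t. curvature L \<gamma> t = norm (T1 t)"
proof -
  define D where "D n = (curve_deriv L ^^ n) \<gamma>" for n
  have L: "0 < L" and dif: "\<And>n t. t \<in> {0..L} \<Longrightarrow> D n differentiable (at t within {0..L})"
    and n1: "\<And>t. t \<in> {0..L} \<Longrightarrow> norm (D 1 t) = 1"
    using assms by (auto simp: smooth_arclength_curve_def smooth_on_interval_def D_def)
  have der: "(D n has_vector_derivative D (Suc n) t) (at t within {0..L})" if "t \<in> {0..L}" for n t
    using dif[OF that, of n] unfolding vector_derivative_works by (simp add: D_def curve_deriv_def)
  have orth: "D 1 t \<bullet> D 2 t = 0" if t: "t \<in> {0..L}" for t
  proof -
    have "((\<lambda>t. D 1 t \<bullet> D 1 t) has_vector_derivative (D 1 t \<bullet> D 2 t + D 2 t \<bullet> D 1 t)) (at t within {0..L})"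
      using bounded_bilinear.has_vector_derivative[OF bounded_bilinear_inner der[OF t, of 1] der[OF t, of 1]]
      by (simp add: numeral_2_eq_2)
    moreover have "((\<lambda>t. D 1 t \<bullet> D 1 t) has_vector_derivative 0) (at t within {0..L})"
      by (rule has_vector_derivative_transform[OF t, of _ "\<lambda>_. 1"]) (use n1 in \<open>auto simp: norm_eq_1\<close>)
    ultimately have "D 1 t \<bullet> D 2 t + D 2 t \<bullet> D 1 t = 0"
      by (rule derivative_within_Icc_unique[OF L t])
    then show ?thesis by (simp add: inner_commute)
  qed
  have cont: "continuous_on {0..L} (D n)" for n
    using dif by (meson continuous_on_eq_continuous_within differentiable_imp_continuous_within)
  show thesis
    by (rule that[of "D 1" "D 2" "D 3"])
      (use L der[of _ 0] der[of _ 1] der[of _ 2] cont[of 3] n1 orth in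
        \<open>auto simp: D_def curvature_def numeral_2_eq_2 numeral_3_eq_3\<close>)
qed

lemma smooth_arclength_curve_continuous:
  assumes "smooth_arclength_curve L \<gamma>" shows "continuous_on {0..L} \<gamma>"
proof -
  have "(curve_deriv L ^^ 0) \<gamma> differentiable (at t within {0..L})" if "t \<in> {0..L}" for t
    using assms that unfolding smooth_arclength_curve_def smooth_on_interval_def by blast
  then show ?thesis
    by (simp add: continuous_on_eq_continuous_within differentiable_imp_continuous_within)
qed

lemma inner_has_real_derivative:
  assumes "(f has_vector_derivative f') (at t within S)"
  shows "((\<lambda>t. \<xi> \<bullet> f t) has_real_derivative \<xi> \<bullet> f') (at t within S)"
  using bounded_linear.has_vector_derivative[OF bounded_linear_inner_right assms]
  by (simp add: has_real_derivative_iff_has_vector_derivative)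

text \<open>
  The Fourier transform of arc length measure on the curve.
\<close>

definition curve_fourier :: "real \<Rightarrow> (real \<Rightarrow> real ^ 2) \<Rightarrow> real ^ 2 \<Rightarrow> complex" where
  "curve_fourier L \<gamma> \<xi> = integral {0..L} (\<lambda>t. cis (\<xi> \<bullet> \<gamma> t))"

text \<open>
  Van der Corput's bound. With \<open>\<xi> = R u\<close>, the phase has derivative \<open>R \<psi>\<close> for the unit direction
  \<open>u\<close> and \<open>\<psi> = u \<bullet> T\<close>. Nonvanishing curvature says \<open>\<psi>'^2 \<ge> k (1 - \<psi>^2)\<close> with \<open>k\<close> the least square
  of the curvature, which is the hypothesis of \<open>integral_inverse_quadratic_le\<close>; all bounds are uniform
  in \<open>u\<close>. The scale \<open>\<eta> = sqrt R\<close>, that is \<open>\<theta> = 1 / sqrt R\<close>, balances the terms of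
  \<open>oscillatory_integral_le\<close>.
\<close>

lemma curve_oscillatory_decay:
  assumes curve: "smooth_arclength_curve L \<gamma>" and curv: "\<forall>t\<in>{0..L}. curvature L \<gamma> t \<noteq> 0"
  shows "\<exists>C>0. \<forall>\<xi>. norm \<xi> \<ge> 1 \<longrightarrow> norm (curve_fourier L \<gamma> \<xi>) \<le> C / sqrt (norm \<xi>)"
proof -
  obtain T T1 T2 where L: "0 < L"
    and d0: "\<And>t. t \<in> {0..L} \<Longrightarrow> (\<gamma> has_vector_derivative T t) (at t within {0..L})"
    and d1: "\<And>t. t \<in> {0..L} \<Longrightarrow> (T has_vector_derivative T1 t) (at t within {0..L})"
    and d2: "\<And>t. t \<in> {0..L} \<Longrightarrow> (T1 has_vector_derivative T2 t) (at t within {0..L})"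
    and c2: "continuous_on {0..L} T2"
    and n1: "\<And>t. t \<in> {0..L} \<Longrightarrow> norm (T t) = 1"
    and orth: "\<And>t. t \<in> {0..L} \<Longrightarrow> T t \<bullet> T1 t = 0"
    and cT: "\<And>t. curvature L \<gamma> t = norm (T1 t)"
    using smooth_arclength_curve_frame[OF curve] by metis
  have c1: "continuous_on {0..L} T1"
    using d2 by (meson continuous_on_eq_continuous_within has_vector_derivative_continuous)
  have ne: "{0..L} \<noteq> {}" using L by simp
  obtain t0 where t0: "t0 \<in> {0..L}" "\<And>t. t \<in> {0..L} \<Longrightarrow> norm (T1 t0) \<le> norm (T1 t)"
    using continuous_attains_inf[OF compact_Icc ne, of "\<lambda>t. norm (T1 t)"] c1 continuous_on_norm by blast
  define k where "k = (norm (T1 t0))\<^sup>2"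
  have k: "k > 0" using curv t0(1) cT by (simp add: k_def)
  obtain M1 where M1: "\<And>t. t \<in> {0..L} \<Longrightarrow> norm (T1 t) \<le> M1"
    using compact_imp_bounded[OF compact_continuous_image[OF c1 compact_Icc]]
    unfolding bounded_iff by (metis imageI)
  obtain M2 where M2: "\<And>t. t \<in> {0..L} \<Longrightarrow> norm (T2 t) \<le> M2"
    using compact_imp_bounded[OF compact_continuous_image[OF c2 compact_Icc]]
    unfolding bounded_iff by (metis imageI)
  define M where "M = max M1 M2"
  have M0: "M \<ge> 0" using order_trans[OF norm_ge_zero M1[of 0]] L by (simp add: M_def le_max_iff_disj)
  define C0 where "C0 = (4 * M + L * (k + 2 * M)) / k"
  have C0: "C0 \<ge> 0" unfolding C0_def using M0 k L by simp
  have main: "norm (curve_fourier L \<gamma> \<xi>) \<le> (2 + (1 + M) * C0) / sqrt (norm \<xi>)" if \<xi>: "norm \<xi> \<ge> 1" for \<xi> :: "real ^ 2"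
  proof -
    define R where "R = norm \<xi>"
    define u where "u = \<xi> /\<^sub>R R"
    define \<theta> where "\<theta> = 1 / sqrt R"
    have R: "R \<ge> 1" using \<xi> by (simp add: R_def)
    have nu: "norm u = 1" using R by (simp add: u_def flip: R_def)
    have Ru: "\<xi> = R *\<^sub>R u" using R by (simp add: u_def)
    have th: "0 < \<theta>" "\<theta> \<le> 1" "\<theta>\<^sup>2 = 1 / R" using R by (auto simp: \<theta>_def power_divide)
    have CS: "\<bar>u \<bullet> v\<bar> \<le> B" if "norm v \<le> B" for v B
      using Cauchy_Schwarz_ineq2[of u v] nu that by simp
    have I: "integral {0..L} (\<lambda>t. 1 / ((u \<bullet> T t)\<^sup>2 + \<theta>\<^sup>2)) \<le> C0 / \<theta>"
      unfolding C0_def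
    proof (rule integral_inverse_quadratic_le[OF L _ _ _ k _ _ _ th(1,2)])
      fix t assume t: "t \<in> {0..L}"
      show "((\<lambda>t. u \<bullet> T t) has_real_derivative u \<bullet> T1 t) (at t within {0..L})"
        by (rule inner_has_real_derivative[OF d1[OF t]])
      show "((\<lambda>t. u \<bullet> T1 t) has_real_derivative u \<bullet> T2 t) (at t within {0..L})"
        by (rule inner_has_real_derivative[OF d2[OF t]])
      show "\<bar>u \<bullet> T1 t\<bar> \<le> M" using M1[OF t] by (intro CS) (simp add: M_def)
      show "\<bar>u \<bullet> T2 t\<bar> \<le> M" using M2[OF t] by (intro CS) (simp add: M_def)
      have "1 - (u \<bullet> T t)\<^sup>2 \<ge> 0" using CS[of "T t" 1] n1[OF t] by (simp add: abs_square_le_1)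
      moreover have "k \<le> (norm (T1 t))\<^sup>2" unfolding k_def using t0(2)[OF t] by (intro power_mono) auto
      ultimately have "k * (1 - (u \<bullet> T t)\<^sup>2) \<le> (norm (T1 t))\<^sup>2 * (1 - (u \<bullet> T t)\<^sup>2)"
        by (intro mult_right_mono)
      then show "k * (1 - (u \<bullet> T t)\<^sup>2) \<le> (u \<bullet> T1 t)\<^sup>2"
        using inner_square_orthogonal_plane[OF n1[OF t] orth[OF t], of u] nu by simp
    qed (intro continuous_intros c2)
    have "norm (curve_fourier L \<gamma> \<xi>) \<le> 2 / sqrt R + ((sqrt R)\<^sup>2 + R * M) *
        integral {0..L} (\<lambda>t. 1 / ((\<xi> \<bullet> T t)\<^sup>2 + (sqrt R)\<^sup>2))"
      unfolding curve_fourier_def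
    proof (rule oscillatory_integral_le[OF L])
      fix t assume t: "t \<in> {0..L}"
      show "((\<lambda>t. \<xi> \<bullet> \<gamma> t) has_real_derivative \<xi> \<bullet> T t) (at t within {0..L})"
        by (rule inner_has_real_derivative[OF d0[OF t]])
      show "((\<lambda>t. \<xi> \<bullet> T t) has_real_derivative \<xi> \<bullet> T1 t) (at t within {0..L})"
        by (rule inner_has_real_derivative[OF d1[OF t]])
      have "\<bar>u \<bullet> T1 t\<bar> \<le> M" using M1[OF t] by (intro CS) (simp add: M_def)
      then show "\<bar>\<xi> \<bullet> T1 t\<bar> \<le> R * M" unfolding Ru using R by (simp add: abs_mult)
    qed (use R in \<open>auto intro!: continuous_intros c1\<close>)
    also have "(\<lambda>t. 1 / ((\<xi> \<bullet> T t)\<^sup>2 + (sqrt R)\<^sup>2)) = (\<lambda>t. (1 / R\<^sup>2) * (1 / ((u \<bullet> T t)\<^sup>2 + \<theta>\<^sup>2)))"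
    proof
      fix t
      have "(\<xi> \<bullet> T t)\<^sup>2 + (sqrt R)\<^sup>2 = R\<^sup>2 * ((u \<bullet> T t)\<^sup>2 + \<theta>\<^sup>2)"
        using R unfolding th(3) Ru by (simp add: power2_eq_square field_simps)
      then show "1 / ((\<xi> \<bullet> T t)\<^sup>2 + (sqrt R)\<^sup>2) = (1 / R\<^sup>2) * (1 / ((u \<bullet> T t)\<^sup>2 + \<theta>\<^sup>2))" by simp
    qed
    also have "integral {0..L} (\<lambda>t. (1 / R\<^sup>2) * (1 / ((u \<bullet> T t)\<^sup>2 + \<theta>\<^sup>2)))
        = (1 / R\<^sup>2) * integral {0..L} (\<lambda>t. 1 / ((u \<bullet> T t)\<^sup>2 + \<theta>\<^sup>2))"
      by (rule integral_mult_right)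
    also have "2 / sqrt R + ((sqrt R)\<^sup>2 + R * M) * ((1 / R\<^sup>2) * integral {0..L} (\<lambda>t. 1 / ((u \<bullet> T t)\<^sup>2 + \<theta>\<^sup>2)))
      \<le> 2 / sqrt R + ((sqrt R)\<^sup>2 + R * M) * ((1 / R\<^sup>2) * (C0 / \<theta>))"
      using I R M0 by (intro add_left_mono mult_left_mono) auto
    also have "\<dots> = (2 + (1 + M) * C0) / sqrt R"
    proof -
      have "((sqrt R)\<^sup>2 + R * M) * ((1 / R\<^sup>2) * (C0 / \<theta>)) = (1 + M) * C0 * (sqrt R / R)"
        using R by (simp add: \<theta>_def power2_eq_square field_simps)
      also have "sqrt R / R = 1 / sqrt R" using R by (simp add: real_div_sqrt field_simps)
      finally show ?thesis by (simp add: add_divide_distrib)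
    qed
    finally show ?thesis by (simp add: R_def)
  qed
  have "2 + (1 + M) * C0 > 0" using M0 C0 by (simp add: add_pos_nonneg)
  then show ?thesis using main by blast
qed

text \<open>
  Equality in the triangle inequality would force the phase to be constant along the curve. Then
  \<open>\<xi>\<close> is orthogonal to the tangent and, after one more derivative, to the normal.
\<close>

lemma curve_oscillatory_strict:
  assumes curve: "smooth_arclength_curve L \<gamma>" and curv: "\<forall>t\<in>{0..L}. curvature L \<gamma> t \<noteq> 0"
    and "\<xi> \<noteq> 0"
  shows "norm (curve_fourier L \<gamma> \<xi>) < L"
proof -
  obtain T T1 T2 where L: "0 < L"
    and d0: "\<And>t. t \<in> {0..L} \<Longrightarrow> (\<gamma> has_vector_derivative T t) (at t within {0..L})"
    and d1: "\<And>t. t \<in> {0..L} \<Longrightarrow> (T has_vector_derivative T1 t) (at t within {0..L})"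
    and n1: "\<And>t. t \<in> {0..L} \<Longrightarrow> norm (T t) = 1"
    and orth: "\<And>t. t \<in> {0..L} \<Longrightarrow> T t \<bullet> T1 t = 0"
    and cT: "\<And>t. curvature L \<gamma> t = norm (T1 t)"
    using smooth_arclength_curve_frame[OF curve] by metis
  have cg: "continuous_on {0..L} \<gamma>"
    using d0 by (meson continuous_on_eq_continuous_within has_vector_derivative_continuous)
  define I where "I = curve_fourier L \<gamma> \<xi>"
  have cc: "continuous_on {0..L} (\<lambda>t. cis (\<xi> \<bullet> \<gamma> t))" by (intro continuous_intros cg)
  have hi: "((\<lambda>t. cis (\<xi> \<bullet> \<gamma> t)) has_integral I) {0..L}"
    unfolding I_def curve_fourier_def by (intro integrable_integral integrable_continuous_real cc)
  have le: "norm I \<le> L"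
    using has_integral_bound[of 1 "\<lambda>t. cis (\<xi> \<bullet> \<gamma> t)" I 0 L] hi L by simp
  have "norm I \<noteq> L"
  proof
    assume eq: "norm I = L"
    define w where "w = cnj I / of_real L"
    have nw: "norm w = 1" using eq L by (simp add: w_def norm_divide)
    have wI: "w * I = of_real L"
      using eq L by (simp add: w_def complex_norm_square[symmetric] mult.commute power2_eq_square)
    have "((\<lambda>t. 1 - Re (w * cis (\<xi> \<bullet> \<gamma> t))) has_integral (L - Re (w * I))) {0..L}"
      using has_integral_diff[OF has_integral_const_real[of 1 0 L]
          has_integral_linear[OF has_integral_mult_right[OF hi, of w] bounded_linear_Re]] L
      by (simp add: o_def)
    then have z: "((\<lambda>t. 1 - Re (w * cis (\<xi> \<bullet> \<gamma> t))) has_integral 0) (cbox 0 L)" using wI by simp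
    have nn: "0 \<le> 1 - Re (w * cis (\<xi> \<bullet> \<gamma> t))" for t
      using complex_Re_le_cmod[of "w * cis (\<xi> \<bullet> \<gamma> t)"] nw by (simp add: norm_mult)
    have one: "w * cis (\<xi> \<bullet> \<gamma> t) = 1" if t: "t \<in> {0..L}" for t
    proof -
      have "1 - Re (w * cis (\<xi> \<bullet> \<gamma> t)) = 0"
      proof (rule has_integral_0_cbox_imp_0[OF _ _ z])
        show "continuous_on (cbox 0 L) (\<lambda>t. 1 - Re (w * cis (\<xi> \<bullet> \<gamma> t)))"
          by (intro continuous_intros) (use cg in simp)
      qed (use nn t L in \<open>auto simp: box_ne_empty\<close>)
      then have r: "Re (w * cis (\<xi> \<bullet> \<gamma> t)) = 1" by simp
      moreover have "(Re (w * cis (\<xi> \<bullet> \<gamma> t)))\<^sup>2 + (Im (w * cis (\<xi> \<bullet> \<gamma> t)))\<^sup>2 = 1"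
        using nw by (simp only: cmod_power2[symmetric] norm_mult norm_cis) simp
      ultimately have "Im (w * cis (\<xi> \<bullet> \<gamma> t)) = 0" by simp
      with r show ?thesis by (simp add: complex_eq_iff)
    qed
    have T0: "\<xi> \<bullet> T t = 0" if t: "t \<in> {0..L}" for t
    proof -
      have "((\<lambda>t. w * cis (\<xi> \<bullet> \<gamma> t)) has_vector_derivative w * (\<i> * of_real (\<xi> \<bullet> T t) * cis (\<xi> \<bullet> \<gamma> t)))
        (at t within {0..L})"
        by (intro has_vector_derivative_mult_right has_vector_derivative_cis
            inner_has_real_derivative d0 t)
      moreover have "((\<lambda>t. w * cis (\<xi> \<bullet> \<gamma> t)) has_vector_derivative 0) (at t within {0..L})"
        by (rule has_vector_derivative_transform[OF t, of _ "\<lambda>_. 1"]) (use one in auto)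
      ultimately have "w * (\<i> * of_real (\<xi> \<bullet> T t) * cis (\<xi> \<bullet> \<gamma> t)) = 0"
        by (rule derivative_within_Icc_unique[OF L t])
      then show ?thesis using nw by auto
    qed
    have t: "0 \<in> {0..L}" using L by simp
    have "((\<lambda>t. \<xi> \<bullet> T t) has_vector_derivative \<xi> \<bullet> T1 0) (at 0 within {0..L})"
      by (rule bounded_linear.has_vector_derivative[OF bounded_linear_inner_right d1[OF t]])
    moreover have "((\<lambda>t. \<xi> \<bullet> T t) has_vector_derivative 0) (at 0 within {0..L})"
      by (rule has_vector_derivative_transform[OF t, of _ "\<lambda>_. 0"]) (use T0 in auto)
    ultimately have "\<xi> \<bullet> T1 0 = 0"
      by (rule derivative_within_Icc_unique[OF L t])
    then have "(norm (T1 0))\<^sup>2 * (norm \<xi>)\<^sup>2 = 0"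
      using inner_square_orthogonal_plane[OF n1[OF t] orth[OF t], of \<xi>] T0[OF t] by simp
    then show False using \<open>\<xi> \<noteq> 0\<close> curv t cT by auto
  qed
  then show ?thesis using le by (simp add: I_def)
qed

text \<open>
  Decay handles all but finitely many frequencies, and strictness handles those.
\<close>

lemma curve_oscillatory_gap:
  assumes curve: "smooth_arclength_curve L \<gamma>" and curv: "\<forall>t\<in>{0..L}. curvature L \<gamma> t \<noteq> 0"
  shows "\<exists>\<rho><L. 0 \<le> \<rho> \<and> (\<forall>n. n \<noteq> 0 \<longrightarrow> norm (curve_fourier L \<gamma> (lattice_vec n)) \<le> \<rho>)"
proof -
  have L: "L > 0" using curve by (simp add: smooth_arclength_curve_def)
  obtain C where C: "C > 0" "\<And>\<xi>. norm \<xi> \<ge> 1 \<Longrightarrow> norm (curve_fourier L \<gamma> \<xi>) \<le> C / sqrt (norm \<xi>)"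
    using curve_oscillatory_decay[OF curve curv] by blast
  \<comment> \<open>From this radius on the decay estimate is at most \<open>L / 2\<close>.\<close>
  define R where "R = max 1 ((2 * C / L)\<^sup>2)"
  define F where "F = {n. n \<noteq> 0 \<and> norm (lattice_vec n) < R}"
  have "F \<subseteq> {- \<lceil>R\<rceil>..\<lceil>R\<rceil>} \<times> {- \<lceil>R\<rceil>..\<lceil>R\<rceil>}"
  proof
    fix n assume "n \<in> F"
    then have n: "norm (lattice_vec n) < R" by (simp add: F_def)
    have "\<bar>real_of_int (fst n)\<bar> \<le> norm (lattice_vec n)" "\<bar>real_of_int (snd n)\<bar> \<le> norm (lattice_vec n)"
      using component_le_norm_cart[of "lattice_vec n" 1] component_le_norm_cart[of "lattice_vec n" 2]
      by (simp_all add: lattice_vec_def)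
    then have "\<bar>real_of_int (fst n)\<bar> \<le> R" "\<bar>real_of_int (snd n)\<bar> \<le> R" using n by linarith+
    then have "\<bar>fst n\<bar> \<le> \<lceil>R\<rceil>" "\<bar>snd n\<bar> \<le> \<lceil>R\<rceil>" by linarith+
    then show "n \<in> {- \<lceil>R\<rceil>..\<lceil>R\<rceil>} \<times> {- \<lceil>R\<rceil>..\<lceil>R\<rceil>}" by (auto simp: mem_Times_iff)
  qed
  then have finF: "finite F" by (rule finite_subset) simp
  define \<rho> where "\<rho> = Max (insert (L / 2) ((\<lambda>n. norm (curve_fourier L \<gamma> (lattice_vec n))) ` F))"
  have ge: "L / 2 \<le> \<rho>" and geF: "\<And>n. n \<in> F \<Longrightarrow> norm (curve_fourier L \<gamma> (lattice_vec n)) \<le> \<rho>"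
    unfolding \<rho>_def using finF by (intro Max_ge; simp)+
  have "\<rho> \<in> insert (L / 2) ((\<lambda>n. norm (curve_fourier L \<gamma> (lattice_vec n))) ` F)"
    unfolding \<rho>_def using finF by (intro Max_in) auto
  then have "\<rho> < L"
    using L curve_oscillatory_strict[OF curve curv] by (auto simp: F_def lattice_vec_eq_0_iff)
  moreover have "norm (curve_fourier L \<gamma> (lattice_vec n)) \<le> \<rho>" if "n \<noteq> 0" for n
  proof (cases "n \<in> F")
    case False
    then have n: "norm (lattice_vec n) \<ge> R" using that by (simp add: F_def)
    then have "norm (curve_fourier L \<gamma> (lattice_vec n)) \<le> C / sqrt (norm (lattice_vec n))" by (intro C) (simp add: R_def)
    also have "\<dots> \<le> C / (2 * C / L)"
    proof (rule divide_left_mono)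
      have "(2 * C / L)\<^sup>2 \<le> norm (lattice_vec n)" using n by (simp add: R_def)
      then have "sqrt ((2 * C / L)\<^sup>2) \<le> sqrt (norm (lattice_vec n))" by (rule real_sqrt_le_mono)
      then show "2 * C / L \<le> sqrt (norm (lattice_vec n))" using C(1) L by simp
      have "norm (lattice_vec n) > 0" using n unfolding R_def by linarith
      then show "0 < sqrt (norm (lattice_vec n)) * (2 * C / L)" using C(1) L by simp
    qed (use C in simp)
    also have "\<dots> = L / 2" using C(1) L by (simp add: field_simps)
    finally show ?thesis using ge by simp
  qed (rule geF)
  ultimately show ?thesis using ge L by (intro exI[of _ \<rho>]) auto
qed

section \<open>Completeness of the exponentials on the circle\<close>

lemma integral_complex_of_real:
  "f integrable_on S \<Longrightarrow> integral S (\<lambda>x. complex_of_real (f x)) = of_real (integral S f)"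
  using integral_linear[OF _ bounded_linear_of_real, of f S] by (simp add: o_def)

definition null_coeffs :: "(real \<Rightarrow> complex) \<Rightarrow> bool" where
  "null_coeffs u \<longleftrightarrow> continuous_on UNIV u \<and>
     (\<forall>k::int. integral {0..2 * pi} (\<lambda>x. u x * cis (of_int k * x)) = 0)"

lemma null_coeffs_linear:
  assumes "null_coeffs u" "null_coeffs v"
  shows "null_coeffs (\<lambda>x. a * u x + b * v x)"
  unfolding null_coeffs_def
proof (intro conjI allI)
  have c: "continuous_on UNIV u" "continuous_on UNIV v" using assms by (auto simp: null_coeffs_def)
  then show "continuous_on UNIV (\<lambda>x. a * u x + b * v x)" by (intro continuous_intros)
  fix k :: int
  have i: "(\<lambda>x. w x * cis (of_int k * x)) integrable_on {0..2 * pi}" if "continuous_on UNIV w" for w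
    by (intro integrable_continuous_real continuous_intros continuous_on_subset[OF that]) auto
  have "integral {0..2 * pi} (\<lambda>x. (a * u x + b * v x) * cis (of_int k * x))
    = integral {0..2 * pi} (\<lambda>x. a * (u x * cis (of_int k * x)) + b * (v x * cis (of_int k * x)))"
    by (simp add: algebra_simps)
  also have "\<dots> = a * integral {0..2 * pi} (\<lambda>x. u x * cis (of_int k * x))
      + b * integral {0..2 * pi} (\<lambda>x. v x * cis (of_int k * x))"
    using i[OF c(1)] i[OF c(2)]
    by (subst integral_add) (auto intro!: integrable_on_mult_right)
  finally show "integral {0..2 * pi} (\<lambda>x. (a * u x + b * v x) * cis (of_int k * x)) = 0"
    using assms by (simp add: null_coeffs_def)
qed

lemma null_coeffs_shift:
  assumes "null_coeffs u" shows "null_coeffs (\<lambda>x. u x * cis (of_int m * x))"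
  unfolding null_coeffs_def
proof (intro conjI allI)
  show "continuous_on UNIV (\<lambda>x. u x * cis (of_int m * x))"
    using assms by (auto simp: null_coeffs_def intro!: continuous_intros)
  fix k :: int
  have "(\<lambda>x. u x * cis (of_int m * x) * cis (of_int k * x)) = (\<lambda>x. u x * cis (of_int (m + k) * x))"
    by (simp add: mult.assoc cis_mult distrib_right)
  then show "integral {0..2 * pi} (\<lambda>x. u x * cis (of_int m * x) * cis (of_int k * x)) = 0"
    using assms by (simp only: null_coeffs_def)
qed

text \<open>
  Because the class of functions with vanishing coefficients is a module over the exponentials, it
  is a module over polynomials in the real and imaginary part of \<open>cis x\<close>. The quantification over
  \<open>u\<close> is what makes the product case of the induction immediate.
\<close>

lemma null_coeffs_mult_polynomial:
  assumes "real_polynomial_function h" "null_coeffs u"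
  shows "null_coeffs (\<lambda>x. u x * of_real (h (cis x)))"
  using assms
proof (induction arbitrary: u rule: real_polynomial_function.induct)
  case (linear h)
  note u = linear.prems
  interpret bounded_linear h by fact
  \<comment> \<open>A real linear functional of \<open>cis x\<close> is a combination of \<open>cis x\<close> and \<open>cis (- x)\<close>.\<close>
  define \<alpha> \<beta> where "\<alpha> = (of_real (h 1) - \<i> * of_real (h \<i>)) / 2" "\<beta> = (of_real (h 1) + \<i> * of_real (h \<i>)) / 2"
  have hc: "of_real (h (cis x)) = \<alpha> * cis (of_int 1 * x) + \<beta> * cis (of_int (- 1) * x)" for x
  proof -
    have "cis x = cos x *\<^sub>R 1 + sin x *\<^sub>R \<i>" by (simp add: complex_eq_iff)
    then have "h (cis x) = cos x * h 1 + sin x * h \<i>" by (simp add: add scaleR)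
    then show ?thesis by (simp add: complex_eq_iff \<alpha>_\<beta>_def field_simps)
  qed
  have "null_coeffs (\<lambda>x. \<alpha> * (u x * cis (of_int 1 * x)) + \<beta> * (u x * cis (of_int (- 1) * x)))"
    by (intro null_coeffs_linear null_coeffs_shift u)
  then show ?case unfolding hc by (simp add: algebra_simps)
next
  case (const c)
  then show ?case using null_coeffs_linear[of u u "of_real c" 0] by (simp add: mult.commute)
next
  case (add f g)
  then show ?case
    using null_coeffs_linear[of "\<lambda>x. u x * of_real (f (cis x))" "\<lambda>x. u x * of_real (g (cis x))" 1 1]
    by (simp add: algebra_simps)
next
  case (mult f g)
  then have "null_coeffs (\<lambda>x. (u x * of_real (f (cis x))) * of_real (g (cis x)))" by blast
  then show ?case by (simp add: mult.assoc)
qed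

lemma periodic_cis_eq:
  fixes u :: "real \<Rightarrow> 'a"
  assumes per: "\<And>x. u (x + 2 * pi) = u x" and "cis x = cis y"
  shows "u x = u y"
proof -
  have 1: "u (x + 2 * pi * real n) = u x" for x n
  proof (induction n)
    case (Suc n)
    then show ?case using per[of "x + 2 * pi * real n"] by (simp add: algebra_simps)
  qed simp
  obtain n :: int where n: "x = y + 2 * pi * n"
    using assms(2) sin_cos_eq_iff[of x y] by (auto simp: complex_eq_iff)
  show ?thesis
  proof (cases "n \<ge> 0")
    case True
    then show ?thesis using 1[of y "nat n"] n by simp
  next
    case False
    then show ?thesis using 1[of x "nat (- n)"] n by simp
  qed
qed

text \<open>
  The branch cut of \<open>Arg\<close> is harmless: near it \<open>Arg2pi\<close> is continuous and, by periodicity, gives the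
  same values of \<open>u\<close>.
\<close>

lemma continuous_on_circle_of_periodic:
  fixes u :: "real \<Rightarrow> 'a::topological_space"
  assumes per: "\<And>x. u (x + 2 * pi) = u x" and c: "continuous_on UNIV u"
  shows "continuous_on (sphere 0 1) (\<lambda>z. u (Arg z))"
  unfolding continuous_on_eq_continuous_within
proof
  fix z :: complex assume z: "z \<in> sphere 0 1"
  have ci: "isCont u x" for x using c by (simp add: continuous_on_eq_continuous_at)
  show "continuous (at z within sphere 0 1) (\<lambda>z. u (Arg z))"
  proof (cases "z \<in> \<real>\<^sub>\<le>\<^sub>0")
    case False
    then have "isCont (\<lambda>z. u (Arg z)) z"
      by (intro isCont_o2[OF continuous_at_Arg] ci)
    then show ?thesis by (rule continuous_at_imp_continuous_within)
  next
    case True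
    then have "z \<notin> \<real>\<^sub>\<ge>\<^sub>0" using z by (auto simp: nonneg_Reals_def nonpos_Reals_def)
    then have "isCont (\<lambda>z. u (Arg2pi z)) z"
      by (intro isCont_o2[OF continuous_at_Arg2pi] ci)
    then have "continuous (at z within sphere 0 1) (\<lambda>z. u (Arg2pi z))"
      by (rule continuous_at_imp_continuous_within)
    then show ?thesis
    proof (rule continuous_transform_within[OF _ zero_less_one z])
      fix w :: complex assume "w \<in> sphere 0 1"
      then have w: "norm w = 1" by simp
      have "cis (Arg2pi w) = w" using Arg2pi_eq[of w] w by (simp add: cis_conv_exp)
      moreover have "cis (Arg w) = w"
        using w by (metis cis_Arg norm_zero sgn_div_norm inverse_1 scaleR_one zero_neq_one)
      ultimately show "u (Arg2pi w) = u (Arg w)" by (intro periodic_cis_eq[of u, OF per]) simp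
    qed
  qed
qed

text \<open>
  Stone--Weierstrass on the unit circle provides polynomials \<open>g\<close> with \<open>g (cis x)\<close> uniformly close
  to \<open>cnj (u x)\<close>. Since \<open>u\<close> is orthogonal to all of these, the integral of \<open>u * cnj u\<close> vanishes.
\<close>

lemma null_coeffs_imp_zero:
  assumes null: "null_coeffs u" and per: "\<And>x. u (x + 2 * pi) = u x"
  shows "u x = 0"
proof -
  have c: "continuous_on UNIV u" using null by (simp add: null_coeffs_def)
  have c': "continuous_on S u" for S using c continuous_on_subset by blast
  define J where "J = integral {0..2 * pi} (\<lambda>x. norm (u x))"
  define I where "I = integral {0..2 * pi} (\<lambda>x. (norm (u x))\<^sup>2)"
  have J0: "J \<ge> 0" unfolding J_def by (intro integral_nonneg integrable_continuous_real continuous_intros c') auto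
  have bound: "I \<le> J * e" if e: "e > 0" for e
  proof -
    have "continuous_on (sphere 0 1) (\<lambda>z. cnj (u (Arg z)))"
      by (intro continuous_on_cnj continuous_on_circle_of_periodic per c)
    then obtain g where g: "polynomial_function g"
      "\<And>z. z \<in> sphere 0 1 \<Longrightarrow> norm (cnj (u (Arg z)) - g z) < e"
      using Stone_Weierstrass_polynomial_function[OF compact_sphere _ e] by metis
    have app: "norm (cnj (u x) - g (cis x)) \<le> e" for x
    proof -
      have "cis (Arg (cis x)) = cis x" by (simp add: cis_Arg)
      then have "u (Arg (cis x)) = u x" by (intro periodic_cis_eq[of u, OF per])
      then show ?thesis using g(2)[of "cis x"] by simp
    qed
    have gc: "continuous_on UNIV (\<lambda>x. g (cis x))"
      by (rule continuous_on_compose2[OF continuous_on_polymonial_function[OF g(1), of UNIV]])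
        (auto intro!: continuous_intros)
    have "real_polynomial_function (Re \<circ> g)" "real_polynomial_function (Im \<circ> g)"
      using g(1) bounded_linear_Re bounded_linear_Im unfolding polynomial_function_def by blast+
    then have "null_coeffs (\<lambda>x. 1 * (u x * of_real ((Re \<circ> g) (cis x))) + \<i> * (u x * of_real ((Im \<circ> g) (cis x))))"
      by (intro null_coeffs_linear null_coeffs_mult_polynomial null)
    moreover have "1 * (u x * of_real ((Re \<circ> g) (cis x))) + \<i> * (u x * of_real ((Im \<circ> g) (cis x)))
      = u x * g (cis x)" for x
      by (subst (3) complex_eq) (simp add: algebra_simps)
    ultimately have "null_coeffs (\<lambda>x. u x * g (cis x))" by simp
    then have z: "integral {0..2 * pi} (\<lambda>x. u x * g (cis x)) = 0"
      unfolding null_coeffs_def by (elim conjE allE[of _ 0]) simp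
    have "complex_of_real I = integral {0..2 * pi} (\<lambda>x. of_real ((norm (u x))\<^sup>2))"
      unfolding I_def
      by (intro integral_complex_of_real[symmetric] integrable_continuous_real continuous_intros c')
    also have "\<dots> = integral {0..2 * pi} (\<lambda>x. u x * cnj (u x)) - integral {0..2 * pi} (\<lambda>x. u x * g (cis x))"
      unfolding complex_norm_square z by simp
    also have "\<dots> = integral {0..2 * pi} (\<lambda>x. u x * cnj (u x) - u x * g (cis x))"
      by (intro integral_diff[symmetric] integrable_continuous_real continuous_intros c'
          continuous_on_subset[OF gc]) auto
    finally have "norm (complex_of_real I) = norm (integral {0..2 * pi} (\<lambda>x. u x * cnj (u x) - u x * g (cis x)))"
      by simp
    also have "\<dots> \<le> integral {0..2 * pi} (\<lambda>x. norm (u x) * e)"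
    proof (rule integral_norm_bound_integral)
      fix x
      have "norm (u x * cnj (u x) - u x * g (cis x)) = norm (u x) * norm (cnj (u x) - g (cis x))"
        by (simp add: norm_mult flip: right_diff_distrib)
      also have "\<dots> \<le> norm (u x) * e" by (intro mult_left_mono app) auto
      finally show "norm (u x * cnj (u x) - u x * g (cis x)) \<le> norm (u x) * e" .
    qed (auto intro!: integrable_continuous_real continuous_intros c' continuous_on_subset[OF gc])
    also have "\<dots> = J * e" unfolding J_def by simp
    finally show ?thesis by simp
  qed
  have "I \<le> 0"
  proof (rule ccontr)
    assume "\<not> I \<le> 0"
    then have "I / (2 * (J + 1)) > 0" using J0 by simp
    then have "I \<le> J * (I / (2 * (J + 1)))" by (rule bound)
    also have "\<dots> < I"
    proof -
      have "0 \<le> I * J" using J0 \<open>\<not> I \<le> 0\<close> by simp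
      then have "0 < I * J + I * 2" using \<open>\<not> I \<le> 0\<close> by linarith
      then have "I * J < I * (2 * (J + 1))" by (simp add: algebra_simps)
      then show ?thesis using J0 by (simp add: divide_less_eq mult.commute)
    qed
    finally show False by simp
  qed
  moreover have "I \<ge> 0"
    unfolding I_def by (intro integral_nonneg integrable_continuous_real continuous_intros c') auto
  ultimately have "I = 0" by simp
  moreover have "((\<lambda>x. (norm (u x))\<^sup>2) has_integral I) {0..2 * pi}"
    unfolding I_def by (intro integrable_integral integrable_continuous_real continuous_intros c')
  ultimately have "((\<lambda>x. (norm (u x))\<^sup>2) has_integral 0) (cbox 0 (2 * pi))" by simp
  then have zero: "u y = 0" if "y \<in> {0..2 * pi}" for y
  proof -
    have "continuous_on (cbox 0 (2 * pi)) (\<lambda>x. (norm (u x))\<^sup>2)" by (intro continuous_intros c')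
    from has_integral_0_cbox_imp_0[OF this _ \<open>(_ has_integral 0) _\<close>, of y]
    show ?thesis using that pi_gt_zero by simp
  qed
  have "cis (Arg2pi (cis x)) = cis x" using Arg2pi_eq[of "cis x"] by (simp add: cis_conv_exp)
  then have "u x = u (Arg2pi (cis x))" by (intro periodic_cis_eq[of u, OF per]) simp
  then show ?thesis using zero[of "Arg2pi (cis x)"] Arg2pi[of "cis x"] by simp
qed

section \<open>Fourier coefficients on the torus\<close>

definition jointly_continuous :: "(real \<Rightarrow> real \<Rightarrow> complex) \<Rightarrow> bool" where
  "jointly_continuous f \<longleftrightarrow> continuous_on UNIV (\<lambda>p. f (fst p) (snd p))"

definition torus_integral :: "(real \<Rightarrow> real \<Rightarrow> complex) \<Rightarrow> complex" where
  "torus_integral f = integral {0..2 * pi} (\<lambda>y. integral {0..2 * pi} (\<lambda>x. f x y))"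

definition wave :: "int \<times> int \<Rightarrow> real \<Rightarrow> real \<Rightarrow> complex" where
  "wave n x y = cis (of_int (fst n) * x + of_int (snd n) * y)"

lemma jointly_continuous_compose:
  assumes "jointly_continuous f" "continuous_on S a" "continuous_on S b"
  shows "continuous_on S (\<lambda>t. f (a t) (b t))"
  using continuous_on_compose2[OF assms(1)[unfolded jointly_continuous_def] continuous_on_Pair[OF assms(2,3)]] by simp

lemma jointly_continuous_wave: "jointly_continuous (wave n)"
  unfolding jointly_continuous_def wave_def by (intro continuous_intros)

lemma jointly_continuous_mult: "jointly_continuous f \<Longrightarrow> jointly_continuous g \<Longrightarrow> jointly_continuous (\<lambda>x y. f x y * g x y)"
  unfolding jointly_continuous_def by (intro continuous_intros)

lemma jointly_continuous_add: "jointly_continuous f \<Longrightarrow> jointly_continuous g \<Longrightarrow> jointly_continuous (\<lambda>x y. f x y + g x y)"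
  unfolding jointly_continuous_def by (intro continuous_intros)

lemma jointly_continuous_const: "jointly_continuous (\<lambda>x y. c)"
  unfolding jointly_continuous_def by (intro continuous_intros)

lemma jointly_continuous_sum: "(\<And>i. i \<in> A \<Longrightarrow> jointly_continuous (f i)) \<Longrightarrow> jointly_continuous (\<lambda>x y. \<Sum>i\<in>A. f i x y)"
  unfolding jointly_continuous_def by (intro continuous_intros)

lemma jointly_continuous_integrable: "jointly_continuous f \<Longrightarrow> (\<lambda>x. f x y) integrable_on {a..b}"
  by (intro integrable_continuous_real jointly_continuous_compose[of f] continuous_intros)

lemma jointly_continuous_integral:
  assumes "jointly_continuous f" shows "continuous_on S (\<lambda>y. integral {a..b} (\<lambda>x. f x y))"
proof -
  have "continuous_on (S \<times> cbox a b) (\<lambda>(y, x). f x y)"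
    unfolding case_prod_beta by (intro jointly_continuous_compose[OF assms] continuous_intros)
  from integral_continuous_on_param[OF this] show ?thesis by simp
qed

lemma torus_integral_add:
  assumes "jointly_continuous f" "jointly_continuous g"
  shows "torus_integral (\<lambda>x y. f x y + g x y) = torus_integral f + torus_integral g"
  unfolding torus_integral_def
  by (simp add: integral_add jointly_continuous_integrable assms integrable_continuous_real jointly_continuous_integral)

lemma torus_integral_mult: "torus_integral (\<lambda>x y. c * f x y) = c * torus_integral f"
  unfolding torus_integral_def by simp

lemma torus_integral_sum:
  assumes "finite A" "\<And>i. i \<in> A \<Longrightarrow> jointly_continuous (f i)"
  shows "torus_integral (\<lambda>x y. \<Sum>i\<in>A. f i x y) = (\<Sum>i\<in>A. torus_integral (f i))"
  using assms
proof (induction A rule: finite_induct)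
  case empty
  show ?case by (simp add: torus_integral_def)
next
  case (insert i A)
  then show ?case using torus_integral_add[of "f i" "\<lambda>x y. \<Sum>i\<in>A. f i x y"] jointly_continuous_sum[of A f] by simp
qed

lemma torus_integral_swap:
  assumes "jointly_continuous f" shows "torus_integral (\<lambda>x y. f y x) = torus_integral f"
proof -
  have "continuous_on (cbox (0, 0) (2 * pi, 2 * pi)) (\<lambda>(x, y). f x y)"
    unfolding case_prod_beta by (intro jointly_continuous_compose[OF assms] continuous_intros)
  from integral_swap_continuous[OF this] show ?thesis by (simp add: torus_integral_def)
qed

lemma integral_cis_int:
  "integral {0..2 * pi} (\<lambda>x. cis (of_int k * x)) = (if k = 0 then of_real (2 * pi) else 0)"
proof (cases "k = 0")
  case False
  have "((\<lambda>x. cis (of_int k * x)) has_integral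
      (cis (of_int k * (2 * pi)) / (\<i> * of_int k) - cis (of_int k * 0) / (\<i> * of_int k))) {0..2 * pi}"
  proof (rule fundamental_theorem_of_calculus)
    fix x :: real
    have "((\<lambda>x. cis (of_int k * x)) has_vector_derivative \<i> * of_real (of_int k) * cis (of_int k * x)) (at x within {0..2 * pi})"
      by (rule has_vector_derivative_cis) (auto intro!: derivative_eq_intros)
    from has_vector_derivative_divide[OF this, of "\<i> * of_int k"]
    show "((\<lambda>x. cis (of_int k * x) / (\<i> * of_int k)) has_vector_derivative cis (of_int k * x)) (at x within {0..2 * pi})"
      using False by simp
  qed simp
  moreover have "cis (of_int k * (2 * pi)) = 1"
    using cis_multiple_2pi[of "of_int k"] by (simp add: mult_ac)
  ultimately show ?thesis using False by (simp add: integral_unique)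
qed (simp add: scaleR_conv_of_real)

lemma torus_integral_wave: "torus_integral (wave n) = (if n = 0 then of_real ((2 * pi)\<^sup>2) else 0)"
proof -
  have "integral {0..2 * pi} (\<lambda>x. wave n x y)
      = cis (of_int (snd n) * y) * integral {0..2 * pi} (\<lambda>x. cis (of_int (fst n) * x))" for y
    by (simp add: wave_def cis_mult[symmetric] mult.commute)
  then show ?thesis
    by (simp add: torus_integral_def integral_cis_int prod_eq_iff power2_eq_square)
qed

lemma wave_add: "wave (m + n) x y = wave m x y * wave n x y"
  by (simp add: wave_def cis_mult algebra_simps)

text \<open>
  The one-dimensional statement is used twice: for each \<open>k\<close>, the \<open>k\<close>-th coefficient in the
  first variable is a function of the second variable without Fourier coefficients.
\<close>

lemma torus_coeffs_zero_imp_zero: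
  assumes f: "jointly_continuous f" and perx: "\<And>x y. f (x + 2 * pi) y = f x y" and pery: "\<And>x y. f x (y + 2 * pi) = f x y"
    and z: "\<And>n. torus_integral (\<lambda>x y. f x y * wave n x y) = 0"
  shows "f x y = 0"
proof -
  define v where "v k y = integral {0..2 * pi} (\<lambda>x. f x y * cis (of_int k * x))" for k :: int and y
  have "v k y = 0" for k y
  proof (rule null_coeffs_imp_zero)
    have "jointly_continuous (\<lambda>x y. f x y * cis (of_int k * x))"
      using f unfolding jointly_continuous_def by (intro continuous_intros)
    then have c: "continuous_on UNIV (v k)" unfolding v_def by (rule jointly_continuous_integral)
    have "integral {0..2 * pi} (\<lambda>y. v k y * cis (of_int l * y)) = 0" for l :: int
    proof -
      have "v k y * cis (of_int l * y) = integral {0..2 * pi} (\<lambda>x. f x y * wave (k, l) x y)" for y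
        unfolding v_def wave_def by (simp add: cis_mult[symmetric] mult.assoc[symmetric])
      then show ?thesis using z[of "(k, l)"] by (simp add: torus_integral_def)
    qed
    then show "null_coeffs (v k)" using c by (simp add: null_coeffs_def)
    show "v k (y + 2 * pi) = v k y" for y by (simp add: v_def pery)
  qed
  then have "null_coeffs (\<lambda>x. f x y)"
    unfolding null_coeffs_def v_def by (auto intro!: jointly_continuous_compose[OF f] continuous_intros)
  then show ?thesis by (rule null_coeffs_imp_zero) (rule perx)
qed

text \<open>
  Two integrations by parts at once: \<open>f'' e - f e''\<close> is the derivative of \<open>f' e - f e'\<close>.
\<close>

lemma integral_second_derivative_cis:
  fixes f f1 f2 :: "real \<Rightarrow> complex"
  assumes d1: "\<And>x. (f has_vector_derivative f1 x) (at x)" and d2: "\<And>x. (f1 has_vector_derivative f2 x) (at x)"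
    and per: "f (2 * pi) = f 0" "f1 (2 * pi) = f1 0" and c2: "continuous_on UNIV f2"
  shows "integral {0..2 * pi} (\<lambda>x. f2 x * cis (of_int k * x))
    = - (of_int k)\<^sup>2 * integral {0..2 * pi} (\<lambda>x. f x * cis (of_int k * x))"
proof -
  define B where "B x = (f1 x - \<i> * of_int k * f x) * cis (of_int k * x)" for x
  have "((\<lambda>x. f2 x * cis (of_int k * x) + (of_int k)\<^sup>2 * (f x * cis (of_int k * x)))
      has_integral (B (2 * pi) - B 0)) {0..2 * pi}"
  proof (rule fundamental_theorem_of_calculus)
    fix x :: real
    have c: "((\<lambda>x. cis (of_int k * x)) has_vector_derivative \<i> * of_real (of_int k) * cis (of_int k * x)) (at x within {0..2 * pi})"
      by (rule has_vector_derivative_cis) (auto intro!: derivative_eq_intros)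
    have "(B has_vector_derivative ((f1 x - \<i> * of_int k * f x) * (\<i> * of_real (of_int k) * cis (of_int k * x))
        + (f2 x - \<i> * of_int k * f1 x) * cis (of_int k * x))) (at x within {0..2 * pi})"
      unfolding B_def
      by (intro has_vector_derivative_mult has_vector_derivative_diff has_vector_derivative_mult_right c
          has_vector_derivative_at_within[OF d1] has_vector_derivative_at_within[OF d2])
    moreover have "(f1 x - \<i> * of_int k * f x) * (\<i> * of_real (of_int k) * cis (of_int k * x))
        + (f2 x - \<i> * of_int k * f1 x) * cis (of_int k * x)
      = f2 x * cis (of_int k * x) + (of_int k)\<^sup>2 * (f x * cis (of_int k * x))"
      by (simp add: algebra_simps power2_eq_square)
    ultimately show "(B has_vector_derivative f2 x * cis (of_int k * x) + (of_int k)\<^sup>2 * (f x * cis (of_int k * x)))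
      (at x within {0..2 * pi})" by simp
  qed simp
  moreover have "B (2 * pi) = B 0"
    using cis_multiple_2pi[of "of_int k"] per by (simp add: B_def mult_ac)
  ultimately have "integral {0..2 * pi} (\<lambda>x. f2 x * cis (of_int k * x) + (of_int k)\<^sup>2 * (f x * cis (of_int k * x))) = 0"
    by (simp add: integral_unique)
  moreover have cf: "continuous_on S f" for S
    using d1 by (meson continuous_at_imp_continuous_on has_vector_derivative_continuous)
  ultimately show ?thesis
    by (subst (asm) integral_add)
      (auto intro!: integrable_continuous_real continuous_intros cf continuous_on_subset[OF c2]
        simp: add_eq_0_iff)
qed

section \<open>Fourier expansion of eigenfunctions\<close>

definition plane :: "real \<Rightarrow> real \<Rightarrow> real ^ 2" where
  "plane x y = vector [x, y]"

lemma plane_nth [simp]: "plane x y $ 1 = x" "plane x y $ 2 = y"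
  by (simp_all add: plane_def)

lemma plane_components [simp]: "plane (v $ 1) (v $ 2) = v"
  by (simp add: vec_eq_iff forall_2)

lemma plane_eq_axis: "plane x y = x *\<^sub>R axis 1 1 + y *\<^sub>R axis 2 1"
  by (simp add: vec_eq_iff forall_2 axis_def)

lemma plane_shift: "plane x y = plane 0 y + x *\<^sub>R axis 1 1" "plane x y = plane x 0 + y *\<^sub>R axis 2 1"
  by (simp_all add: vec_eq_iff forall_2 axis_def)

lemma continuous_on_plane [continuous_intros]:
  "continuous_on S f \<Longrightarrow> continuous_on S g \<Longrightarrow> continuous_on S (\<lambda>x. plane (f x) (g x))"
  unfolding plane_eq_axis by (intro continuous_intros)

lemma jointly_continuous_plane:
  assumes "continuous_on UNIV G" shows "jointly_continuous (\<lambda>x y. complex_of_real (G (plane x y)))"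
  unfolding jointly_continuous_def
  by (intro continuous_intros continuous_on_compose2[OF assms]) auto

lemma partial_deriv_along_axis:
  assumes "\<And>x. F differentiable (at x)"
  shows "((\<lambda>s. F (p + s *\<^sub>R axis i 1)) has_real_derivative partial_deriv i F (p + s *\<^sub>R axis i 1)) (at s)"
proof -
  define D where "D = frechet_derivative F (at (p + s *\<^sub>R axis i 1))"
  have D: "(F has_derivative D) (at (p + s *\<^sub>R axis i 1))"
    unfolding D_def using assms frechet_derivative_works by blast
  have "((\<lambda>s. p + s *\<^sub>R axis i 1) has_derivative (\<lambda>h. h *\<^sub>R axis i 1)) (at s)"
    by (auto intro!: derivative_eq_intros)
  from has_derivative_compose[OF this D]
  have "((\<lambda>s. F (p + s *\<^sub>R axis i 1)) has_derivative (\<lambda>h. D (h *\<^sub>R axis i 1))) (at s)" .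
  moreover have "D (h *\<^sub>R axis i 1) = partial_deriv i F (p + s *\<^sub>R axis i 1) * h" for h
    using linear_scale[OF has_derivative_linear[OF D], of h "axis i 1"] by (simp add: partial_deriv_def D_def)
  ultimately show ?thesis by (simp add: has_field_derivative_def)
qed

lemma partial_deriv_periodic:
  assumes "\<And>x. F differentiable (at x)" "\<And>x. F (x + v) = F x"
  shows "partial_deriv i F (x + v) = partial_deriv i F x"
proof -
  have "F (x + v + s *\<^sub>R axis i 1) = F (x + s *\<^sub>R axis i 1)" for s
    using assms(2)[of "x + s *\<^sub>R axis i 1"] by (simp add: add_ac)
  then have "((\<lambda>s. F (x + s *\<^sub>R axis i 1)) has_real_derivative partial_deriv i F (x + v)) (at 0)"
    using partial_deriv_along_axis[OF assms(1), of "x + v" i 0] by simp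
  then show ?thesis using partial_deriv_along_axis[OF assms(1), of x i 0] DERIV_unique by fastforce
qed

lemma torus_periodic_axis:
  assumes "torus_periodic F" shows "F (x + (2 * pi) *\<^sub>R axis i 1) = F x"
proof -
  have "(\<chi> j. 2 * pi * of_int ((axis i 1 :: int ^ 2) $ j)) = ((2 * pi) *\<^sub>R axis i 1 :: real ^ 2)"
    by (simp add: vec_eq_iff axis_def)
  then show ?thesis using assms unfolding torus_periodic_def by metis
qed

text \<open>
  The Laplacian multiplies the coefficient at frequency \<open>n\<close> by \<open>- |n|^2\<close> and, by the eigenvalue
  equation, also by \<open>- lam^2\<close>. The second pure derivative in each variable is treated by integrating
  over that variable first.
\<close>

lemma torus_eigenfunction_coeffs:
  assumes ef: "torus_eigenfunction lam F"
  defines "f \<equiv> \<lambda>x y. complex_of_real (F (plane x y))"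
  shows "(of_real (lam\<^sup>2) - (of_int (fst n))\<^sup>2 - (of_int (snd n))\<^sup>2)
    * torus_integral (\<lambda>x y. f x y * wave n x y) = 0"
proof -
  have per: "torus_periodic F" and dF: "\<And>x. F differentiable (at x)"
    and dP: "\<And>i x. partial_deriv i F differentiable (at x)"
    and cP: "\<And>i j. continuous_on UNIV (partial_deriv j (partial_deriv i F))"
    and lap: "\<And>x. - laplacian F x = lam\<^sup>2 * F x"
    using ef by (auto simp: torus_eigenfunction_def numeral_2_eq_2)
  have cF: "continuous_on UNIV F"
    using dF by (meson continuous_at_imp_continuous_on differentiable_imp_continuous_within)
  have p0: "F (x + (2 * pi) *\<^sub>R axis i 1) = F x" for x i by (rule torus_periodic_axis[OF per])
  have p1: "partial_deriv i F (x + (2 * pi) *\<^sub>R axis i 1) = partial_deriv i F x" for x i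
    by (rule partial_deriv_periodic[OF dF p0])
  define g where "g i x y = complex_of_real (partial_deriv i (partial_deriv i F) (plane x y))" for i x y
  have cf: "jointly_continuous f" and cg: "jointly_continuous (g i)" for i
    unfolding f_def g_def by (intro jointly_continuous_plane cF cP)+
  have line: "integral {0..2 * pi} (\<lambda>s. complex_of_real (partial_deriv i (partial_deriv i F) (p + s *\<^sub>R axis i 1)) * cis (of_int k * s))
      = - (of_int k)\<^sup>2 * integral {0..2 * pi} (\<lambda>s. complex_of_real (F (p + s *\<^sub>R axis i 1)) * cis (of_int k * s))"
    for i p and k :: int
  proof (rule integral_second_derivative_cis)
    show "((\<lambda>s. complex_of_real (F (p + s *\<^sub>R axis i 1))) has_vector_derivative
        complex_of_real (partial_deriv i F (p + s *\<^sub>R axis i 1))) (at s)" for s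
      by (intro has_vector_derivative_of_real partial_deriv_along_axis dF)
    show "((\<lambda>s. complex_of_real (partial_deriv i F (p + s *\<^sub>R axis i 1))) has_vector_derivative
        complex_of_real (partial_deriv i (partial_deriv i F) (p + s *\<^sub>R axis i 1))) (at s)" for s
      by (intro has_vector_derivative_of_real partial_deriv_along_axis dP)
    show "continuous_on UNIV (\<lambda>s. complex_of_real (partial_deriv i (partial_deriv i F) (p + s *\<^sub>R axis i 1)))"
      by (intro continuous_intros continuous_on_compose2[OF cP]) auto
  qed (simp_all add: p0 p1)
  have row: "integral {0..2 * pi} (\<lambda>x. g 1 x y * cis (of_int k * x))
      = - (of_int k)\<^sup>2 * integral {0..2 * pi} (\<lambda>x. f x y * cis (of_int k * x))" for y and k :: int
    using line[of 1 "plane 0 y" k] by (simp add: g_def f_def flip: plane_shift(1))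
  have col: "integral {0..2 * pi} (\<lambda>y. g 2 x y * cis (of_int k * y))
      = - (of_int k)\<^sup>2 * integral {0..2 * pi} (\<lambda>y. f x y * cis (of_int k * y))" for x and k :: int
    using line[of 2 "plane x 0" k] by (simp add: g_def f_def flip: plane_shift(2))
  obtain k l where n: "n = (k, l)" by (cases n)
  have wx: "integral {0..2 * pi} (\<lambda>x. h x y * wave n x y)
      = integral {0..2 * pi} (\<lambda>x. h x y * cis (of_int k * x)) * cis (of_int l * y)" for h y
    by (simp add: n wave_def cis_mult[symmetric] mult.assoc[symmetric])
  have wy: "integral {0..2 * pi} (\<lambda>y. h x y * wave n x y)
      = integral {0..2 * pi} (\<lambda>y. h x y * cis (of_int l * y)) * cis (of_int k * x)" for h x
  proof -
    have "(\<lambda>y. h x y * wave n x y) = (\<lambda>y. h x y * cis (of_int l * y) * cis (of_int k * x))"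
      by (simp add: n wave_def cis_mult[symmetric] mult_ac)
    then show ?thesis by simp
  qed
  have 1: "torus_integral (\<lambda>x y. g 1 x y * wave n x y) = - (of_int k)\<^sup>2 * torus_integral (\<lambda>x y. f x y * wave n x y)"
    unfolding torus_integral_def wx row by (simp add: mult.assoc)
  have "torus_integral (\<lambda>x y. g 2 x y * wave n x y) = torus_integral (\<lambda>x y. g 2 y x * wave n y x)"
    by (rule torus_integral_swap[symmetric]) (intro jointly_continuous_mult cg jointly_continuous_wave)
  also have "\<dots> = - (of_int l)\<^sup>2 * torus_integral (\<lambda>x y. f y x * wave n y x)"
    unfolding torus_integral_def wy col by (simp add: mult.assoc)
  also have "torus_integral (\<lambda>x y. f y x * wave n y x) = torus_integral (\<lambda>x y. f x y * wave n x y)"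
    by (rule torus_integral_swap) (intro jointly_continuous_mult cf jointly_continuous_wave)
  finally have 2: "torus_integral (\<lambda>x y. g 2 x y * wave n x y) = - (of_int l)\<^sup>2 * torus_integral (\<lambda>x y. f x y * wave n x y)" .
  have "g 1 x y + g 2 x y = - of_real (lam\<^sup>2) * f x y" for x y
  proof -
    have "partial_deriv 1 (partial_deriv 1 F) (plane x y) + partial_deriv 2 (partial_deriv 2 F) (plane x y)
        = - lam\<^sup>2 * F (plane x y)"
      using lap[of "plane x y"] by (simp add: laplacian_def sum_2)
    then show ?thesis unfolding g_def f_def by (metis of_real_add of_real_minus of_real_mult)
  qed
  then have "(\<lambda>x y. g 1 x y * wave n x y + g 2 x y * wave n x y)
      = (\<lambda>x y. - of_real (lam\<^sup>2) * (f x y * wave n x y))"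
    by (simp add: fun_eq_iff mult.assoc[symmetric] flip: distrib_right)
  then have "- of_real (lam\<^sup>2) * torus_integral (\<lambda>x y. f x y * wave n x y)
      = torus_integral (\<lambda>x y. g 1 x y * wave n x y + g 2 x y * wave n x y)"
    by (simp only: torus_integral_mult)
  also have "\<dots> = torus_integral (\<lambda>x y. g 1 x y * wave n x y) + torus_integral (\<lambda>x y. g 2 x y * wave n x y)"
    by (intro torus_integral_add jointly_continuous_mult cg jointly_continuous_wave)
  finally have "- of_real (lam\<^sup>2) * torus_integral (\<lambda>x y. f x y * wave n x y)
      = - (of_int k)\<^sup>2 * torus_integral (\<lambda>x y. f x y * wave n x y)
        + - (of_int l)\<^sup>2 * torus_integral (\<lambda>x y. f x y * wave n x y)"
    unfolding 1 2 .
  then show ?thesis by (simp add: n algebra_simps)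
qed

lemma torus_integral_wave_sum:
  assumes "finite A"
  shows "torus_integral (\<lambda>x y. (\<Sum>m\<in>A. a m * wave m x y) * wave n x y)
    = (if - n \<in> A then of_real ((2 * pi)\<^sup>2) * a (- n) else 0)"
proof -
  have "(\<lambda>x y. (\<Sum>m\<in>A. a m * wave m x y) * wave n x y) = (\<lambda>x y. \<Sum>m\<in>A. a m * wave (m + n) x y)"
    by (simp add: sum_distrib_right wave_add mult.assoc)
  then have "torus_integral (\<lambda>x y. (\<Sum>m\<in>A. a m * wave m x y) * wave n x y)
      = (\<Sum>m\<in>A. torus_integral (\<lambda>x y. a m * wave (m + n) x y))"
    using torus_integral_sum[OF assms, of "\<lambda>m x y. a m * wave (m + n) x y"]
    by (simp add: jointly_continuous_mult jointly_continuous_const jointly_continuous_wave)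
  also have "\<dots> = (\<Sum>m\<in>A. if m = - n then of_real ((2 * pi)\<^sup>2) * a m else 0)"
    by (intro sum.cong) (auto simp: torus_integral_mult torus_integral_wave add_eq_0_iff2)
  also have "\<dots> = (if - n \<in> A then of_real ((2 * pi)\<^sup>2) * a (- n) else 0)"
    using assms by (simp add: sum.delta)
  finally show ?thesis .
qed

text \<open>
  The difference of \<open>F\<close> and its candidate expansion has no Fourier coefficients: on \<open>A\<close> by the choice
  of \<open>a\<close>, elsewhere because those of \<open>F\<close> vanish.
\<close>

lemma torus_eigenfunction_expansion:
  assumes ef: "torus_eigenfunction lam F"
    and A: "A = {n. (real_of_int (fst n))\<^sup>2 + (real_of_int (snd n))\<^sup>2 = lam\<^sup>2}" and fin: "finite A"
  shows "\<exists>a. \<forall>x. complex_of_real (F x) = (\<Sum>n\<in>A. a n * wave n (x $ 1) (x $ 2))"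
proof -
  define f where "f x y = complex_of_real (F (plane x y))" for x y
  define a where "a n = torus_integral (\<lambda>x y. f x y * wave (- n) x y) / of_real ((2 * pi)\<^sup>2)" for n
  define P where "P x y = (\<Sum>n\<in>A. a n * wave n x y)" for x y
  have per: "torus_periodic F" and dF: "\<And>x. F differentiable (at x)"
    using ef by (auto simp: torus_eigenfunction_def numeral_2_eq_2)
  have cF: "continuous_on UNIV F"
    using dF by (meson continuous_at_imp_continuous_on differentiable_imp_continuous_within)
  have cf: "jointly_continuous f" unfolding f_def by (rule jointly_continuous_plane[OF cF])
  have cP: "jointly_continuous P" unfolding P_def by (intro jointly_continuous_sum jointly_continuous_mult jointly_continuous_const jointly_continuous_wave)
  have wper: "wave n (x + 2 * pi) y = wave n x y" "wave n x (y + 2 * pi) = wave n x y" for n x y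
  proof -
    have "cis (2 * pi * of_int k) = 1" for k :: int by (simp add: cis_multiple_2pi)
    moreover have "wave n (x + 2 * pi) y = wave n x y * cis (2 * pi * of_int (fst n))"
      "wave n x (y + 2 * pi) = wave n x y * cis (2 * pi * of_int (snd n))"
      by (simp_all add: wave_def cis_mult algebra_simps)
    ultimately show "wave n (x + 2 * pi) y = wave n x y" "wave n x (y + 2 * pi) = wave n x y" by simp_all
  qed
  have fper: "f (x + 2 * pi) y = f x y" "f x (y + 2 * pi) = f x y" for x y
  proof -
    have "plane (x + 2 * pi) y = plane x y + (2 * pi) *\<^sub>R axis 1 1"
      "plane x (y + 2 * pi) = plane x y + (2 * pi) *\<^sub>R axis 2 1"
      by (simp_all add: vec_eq_iff forall_2 axis_def)
    then show "f (x + 2 * pi) y = f x y" "f x (y + 2 * pi) = f x y"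
      by (simp_all add: f_def torus_periodic_axis[OF per])
  qed
  have "f x y + (- 1) * P x y = 0" for x y
  proof (rule torus_coeffs_zero_imp_zero[of "\<lambda>x y. f x y + (- 1) * P x y"])
    show "jointly_continuous (\<lambda>x y. f x y + (- 1) * P x y)" by (intro jointly_continuous_add jointly_continuous_mult jointly_continuous_const cf cP)
    fix n
    have "torus_integral (\<lambda>x y. (f x y + (- 1) * P x y) * wave n x y)
        = torus_integral (\<lambda>x y. f x y * wave n x y + (- 1) * (P x y * wave n x y))"
      by (simp add: algebra_simps)
    also have "\<dots> = torus_integral (\<lambda>x y. f x y * wave n x y) + (- 1) * torus_integral (\<lambda>x y. P x y * wave n x y)"
      unfolding torus_integral_mult[symmetric]
      by (intro torus_integral_add jointly_continuous_mult cf cP jointly_continuous_wave jointly_continuous_const)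
    also have "torus_integral (\<lambda>x y. P x y * wave n x y)
        = (if - n \<in> A then of_real ((2 * pi)\<^sup>2) * a (- n) else 0)"
      unfolding P_def by (rule torus_integral_wave_sum[OF fin])
    also have "\<dots> = torus_integral (\<lambda>x y. f x y * wave n x y)"
    proof (cases "- n \<in> A")
      case True
      then show ?thesis by (simp add: a_def)
    next
      case False
      then have "lam\<^sup>2 - (of_int (fst n))\<^sup>2 - (of_int (snd n))\<^sup>2 \<noteq> 0" by (simp add: A)
      then have "complex_of_real (lam\<^sup>2 - (of_int (fst n))\<^sup>2 - (of_int (snd n))\<^sup>2) \<noteq> 0"
        using of_real_eq_0_iff by blast
      then have "torus_integral (\<lambda>x y. f x y * wave n x y) = 0"
        using torus_eigenfunction_coeffs[OF ef, of n] by (simp add: f_def)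
      then show ?thesis using False by simp
    qed
    finally show "torus_integral (\<lambda>x y. (f x y + (- 1) * P x y) * wave n x y) = 0" by simp
  qed (simp_all add: fper wper P_def)
  then have "f x y = P x y" for x y by (metis add_eq_0_iff mult_minus1 minus_minus)
  then have "complex_of_real (F v) = P (v $ 1) (v $ 2)" for v
    using f_def[of "v $ 1" "v $ 2"] by simp
  then show ?thesis unfolding P_def by blast
qed

lemma integral_cbox_plane:
  fixes G :: "real ^ 2 \<Rightarrow> real"
  assumes G: "continuous_on UNIV G"
  shows "integral (cbox 0 (\<chi> i. 2 * pi)) G
    = integral {0..2 * pi} (\<lambda>y. integral {0..2 * pi} (\<lambda>x. G (plane x y)))"
proof -
  \<comment> \<open>The coordinates are swapped so that Fubini puts the second variable outside.\<close>
  define g where "g = (\<lambda>p :: real \<times> real. plane (snd p) (fst p))"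
  define h where "h = (\<lambda>v :: real ^ 2. (v $ 2, v $ 1))"
  have hg: "h (g x) = x" and gh: "g (h y) = y" for x y by (simp_all add: g_def h_def)
  have hbox: "h ` cbox a b = cbox (h a) (h b)" for a b
  proof
    show "h ` cbox a b \<subseteq> cbox (h a) (h b)" by (auto simp: h_def mem_box_cart cbox_Pair_eq)
    show "cbox (h a) (h b) \<subseteq> h ` cbox a b"
    proof
      fix p assume "p \<in> cbox (h a) (h b)"
      then have "g p \<in> cbox a b" by (auto simp: h_def g_def mem_box_cart cbox_Pair_eq forall_2)
      then show "p \<in> h ` cbox a b" using hg by (metis imageI)
    qed
  qed
  have gbox: "g ` cbox a b = cbox (g a) (g b)" for a b
  proof -
    have "g ` cbox a b = g ` h ` cbox (g a) (g b)" by (simp add: hbox hg)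
    then show ?thesis by (simp add: image_image gh)
  qed
  have cont: "measure lborel (g ` cbox u v) = 1 * measure lborel (cbox u v)" for u v
  proof (cases "cbox u v = {}")
    case False
    then have ne: "cbox (g u) (g v) \<noteq> {}" using gbox by (metis image_is_empty)
    have "u = (fst u, snd u)" "v = (fst v, snd v)" by simp_all
    then have "measure lborel (cbox u v) = measure lborel {fst u..fst v} * measure lborel {snd u..snd v}"
      by (metis content_Pair box_real(2))
    moreover have "fst u \<le> fst v" "snd u \<le> snd v"
      using False by (cases u; cases v; auto simp: cbox_Pair_eq)+
    ultimately show ?thesis
      unfolding gbox content_cbox_cart[OF ne] by (simp add: UNIV_2 g_def)
  qed simp
  have int: "(G has_integral integral (cbox 0 (\<chi> i. 2 * pi)) G) (cbox 0 (\<chi> i. 2 * pi))"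
    by (intro integrable_integral integrable_continuous continuous_on_subset[OF G]) auto
  have "((\<lambda>p. G (g p)) has_integral (1 / 1) *\<^sub>R integral (cbox 0 (\<chi> i. 2 * pi)) G) (h ` cbox 0 (\<chi> i. 2 * pi))"
  proof (rule has_integral_twiddle[OF zero_less_one hg gh _ _ _ cont int])
    show "isCont g x" for x
      using continuous_on_plane[OF continuous_on_snd[OF continuous_on_id] continuous_on_fst[OF continuous_on_id], of UNIV]
      by (cases x) (simp add: g_def continuous_on_eq_continuous_at)
    show "\<exists>w z. g ` cbox u v = cbox w z" for u v using gbox by blast
    show "\<exists>w z. h ` cbox u v = cbox w z" for u v using hbox by blast
  qed
  then have "((\<lambda>p. G (g p)) has_integral integral (cbox 0 (\<chi> i. 2 * pi)) G) (cbox (0, 0) (2 * pi, 2 * pi))"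
    unfolding hbox by (simp add: h_def)
  then have "integral (cbox 0 (\<chi> i. 2 * pi)) G = integral (cbox (0, 0) (2 * pi, 2 * pi)) (\<lambda>p. G (g p))"
    by (simp add: integral_unique)
  also have "\<dots> = integral (cbox 0 (2 * pi)) (\<lambda>y. integral (cbox 0 (2 * pi)) (\<lambda>x. G (g (y, x))))"
  proof (rule integral_prod_continuous)
    show "continuous_on (cbox (0, 0) (2 * pi, 2 * pi)) (\<lambda>p. G (g p))"
      unfolding g_def by (intro continuous_on_compose2[OF G] continuous_intros) auto
  qed
  finally show ?thesis by (simp add: g_def)
qed

lemma torus_L2_norm_expansion:
  assumes cF: "continuous_on UNIV F" and fin: "finite A"
    and exp: "\<And>x. complex_of_real (F x) = (\<Sum>n\<in>A. a n * wave n (x $ 1) (x $ 2))"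
  shows "(torus_L2_norm F)\<^sup>2 = (2 * pi)\<^sup>2 * (\<Sum>n\<in>A. (norm (a n))\<^sup>2)"
proof -
  define I where "I = integral (cbox 0 (\<chi> i. 2 * pi)) (\<lambda>x. \<bar>F x\<bar>\<^sup>2)"
  define f where "f x y = complex_of_real (F (plane x y))" for x y
  have fexp: "f x y = (\<Sum>n\<in>A. a n * wave n x y)" for x y using exp[of "plane x y"] by (simp add: f_def)
  have cG: "continuous_on UNIV (\<lambda>x. \<bar>F x\<bar>\<^sup>2)" by (intro continuous_intros cF)
  have cf: "jointly_continuous f" unfolding f_def by (rule jointly_continuous_plane[OF cF])
  have cw: "cnj (wave n x y) = wave (- n) x y" for n x y
    by (simp add: wave_def cis_cnj algebra_simps)
  have sq: "complex_of_real (\<bar>F (plane x y)\<bar>\<^sup>2) = (\<Sum>n\<in>A. cnj (a n) * (f x y * wave (- n) x y))" for x y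
  proof -
    have "complex_of_real (\<bar>F (plane x y)\<bar>\<^sup>2) = f x y * cnj (f x y)"
      by (simp add: f_def power2_eq_square)
    also have "cnj (f x y) = (\<Sum>n\<in>A. cnj (a n) * wave (- n) x y)" by (simp add: fexp cw)
    finally show ?thesis by (simp add: sum_distrib_left mult_ac)
  qed
  have cc: "jointly_continuous (\<lambda>x y. complex_of_real (\<bar>F (plane x y)\<bar>\<^sup>2))" by (rule jointly_continuous_plane[OF cG])
  have cin: "continuous_on S (\<lambda>x. \<bar>F (plane x y)\<bar>\<^sup>2)" for S y
    by (intro continuous_on_compose2[OF cG] continuous_intros) auto
  have inner: "complex_of_real (integral {0..2 * pi} (\<lambda>x. \<bar>F (plane x y)\<bar>\<^sup>2))
      = integral {0..2 * pi} (\<lambda>x. complex_of_real (\<bar>F (plane x y)\<bar>\<^sup>2))" for y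
    by (intro integral_complex_of_real[symmetric] integrable_continuous_real cin)
  have "continuous_on {0..2 * pi} (\<lambda>y. Re (complex_of_real (integral {0..2 * pi} (\<lambda>x. \<bar>F (plane x y)\<bar>\<^sup>2))))"
    unfolding inner by (intro continuous_intros jointly_continuous_integral[OF cc])
  then have co: "continuous_on {0..2 * pi} (\<lambda>y. integral {0..2 * pi} (\<lambda>x. \<bar>F (plane x y)\<bar>\<^sup>2))" by simp
  have "complex_of_real I = torus_integral (\<lambda>x y. complex_of_real (\<bar>F (plane x y)\<bar>\<^sup>2))"
    unfolding I_def integral_cbox_plane[OF cG] torus_integral_def inner[symmetric]
    by (intro integral_complex_of_real[symmetric] integrable_continuous_real co)
  also have "\<dots> = (\<Sum>n\<in>A. torus_integral (\<lambda>x y. cnj (a n) * (f x y * wave (- n) x y)))"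
    unfolding sq by (intro torus_integral_sum[OF fin] jointly_continuous_mult jointly_continuous_const cf jointly_continuous_wave)
  also have "\<dots> = (\<Sum>n\<in>A. cnj (a n) * (of_real ((2 * pi)\<^sup>2) * a n))"
    using torus_integral_wave_sum[OF fin, of a]
    by (intro sum.cong refl) (simp add: torus_integral_mult fexp)
  also have "\<dots> = of_real ((2 * pi)\<^sup>2 * (\<Sum>n\<in>A. (norm (a n))\<^sup>2))"
    unfolding of_real_mult of_real_sum complex_norm_square sum_distrib_left
    by (intro sum.cong refl) (simp only: mult_ac)
  finally have I: "I = (2 * pi)\<^sup>2 * (\<Sum>n\<in>A. (norm (a n))\<^sup>2)" using of_real_eq_iff by blast
  then have "I \<ge> 0" by (simp add: sum_nonneg)
  then show ?thesis using I by (simp add: torus_L2_norm_def I_def)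
qed

section \<open>Restriction of eigenfunctions to the curve\<close>

lemma wave_eq_cis_inner: "wave n (v $ 1) (v $ 2) = cis (lattice_vec n \<bullet> v)"
  by (simp add: wave_def lattice_vec_def inner_vec_def sum_2)

text \<open>
  The diagonal contributes \<open>L\<close> times the sum of squares. By the arithmetic-geometric mean inequality
  and the symmetry of the weight \<open>w\<close>, the off-diagonal terms cost at most the largest row sum of \<open>w\<close>.
  In a row, \<open>\<epsilon>\<close> is counted at every place and \<open>\<rho>\<close> at most once.
\<close>

lemma quadratic_form_lower_bound:
  fixes s :: "int \<times> int \<Rightarrow> complex" and a :: "int \<times> int \<Rightarrow> complex"
  assumes fin: "finite A" and s0: "s 0 = of_real L"
    and near: "\<And>n. n \<noteq> 0 \<Longrightarrow> norm (s n) \<le> \<rho>" and rho: "\<rho> \<ge> 0"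
    and far: "\<And>n m. n \<in> A \<Longrightarrow> m \<in> A \<Longrightarrow> n \<noteq> m \<Longrightarrow> \<not> R n m \<Longrightarrow> norm (s (n - m)) \<le> \<epsilon>" and eps: "\<epsilon> \<ge> 0"
    and sym: "\<And>n m. R n m \<longleftrightarrow> R m n"
    and one: "\<And>n. n \<in> A \<Longrightarrow> card {m \<in> A. m \<noteq> n \<and> R n m} \<le> 1"
  shows "(L - \<rho> - real (card A) * \<epsilon>) * (\<Sum>n\<in>A. (norm (a n))\<^sup>2)
    \<le> Re (\<Sum>n\<in>A. \<Sum>m\<in>A. a n * cnj (a m) * s (n - m))"
proof -
  define w where "w n m = (if m \<noteq> n \<and> R n m then \<rho> else 0) + \<epsilon>" for n m
  define d where "d n m = (if m = n then 1 else 0 :: real)" for n m :: "int \<times> int"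
  define S where "S = (\<Sum>n\<in>A. (norm (a n))\<^sup>2)"
  have w0: "w n m \<ge> 0" for n m using rho eps by (simp add: w_def)
  have wsym: "w n m = w m n" for n m using sym by (auto simp: w_def)
  have entry: "Re (a n * cnj (a m) * s (n - m)) \<ge>
      d n m * (L * (norm (a n))\<^sup>2) - w n m * (((norm (a n))\<^sup>2 + (norm (a m))\<^sup>2) / 2)"
    if nm: "n \<in> A" "m \<in> A" for n m
  proof (cases "m = n")
    case True
    have "a n * cnj (a n) * s 0 = of_real ((norm (a n))\<^sup>2 * L)"
      by (simp only: complex_norm_square s0 of_real_mult)
    then have "Re (a n * cnj (a n) * s 0) = L * (norm (a n))\<^sup>2" by simp
    moreover have "0 \<le> w n n * (((norm (a n))\<^sup>2 + (norm (a n))\<^sup>2) / 2)"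
      by (intro mult_nonneg_nonneg w0) auto
    ultimately show ?thesis using True by (simp add: d_def)
  next
    case False
    have "norm (s (n - m)) \<le> w n m"
    proof (cases "R n m")
      case True
      then show ?thesis using near[of "n - m"] False eps by (simp add: w_def)
    next
      case nR: False
      then show ?thesis using far[OF nm] False by (simp add: w_def)
    qed
    then have "norm (a n * cnj (a m) * s (n - m)) \<le> (norm (a n) * norm (a m)) * w n m"
      by (simp add: norm_mult mult_left_mono)
    also have "\<dots> \<le> (((norm (a n))\<^sup>2 + (norm (a m))\<^sup>2) / 2) * w n m"
      using sum_squares_bound[of "norm (a n)" "norm (a m)"] by (intro mult_right_mono w0) simp
    finally show ?thesis
      using abs_Re_le_cmod[of "a n * cnj (a m) * s (n - m)"] False by (simp add: d_def mult.commute)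
  qed
  have rows: "(\<Sum>m\<in>A. w n m) \<le> \<rho> + real (card A) * \<epsilon>" if n: "n \<in> A" for n
  proof -
    have "(\<Sum>m\<in>A. if m \<noteq> n \<and> R n m then \<rho> else 0) = real (card {m \<in> A. m \<noteq> n \<and> R n m}) * \<rho>"
      using fin by (simp add: sum.If_cases Int_def)
    also have "\<dots> \<le> 1 * \<rho>" using one[OF n] rho by (intro mult_right_mono) auto
    finally show ?thesis by (simp add: w_def sum.distrib)
  qed
  have half: "(\<Sum>n\<in>A. \<Sum>m\<in>A. w n m * (norm (a n))\<^sup>2) \<le> (\<rho> + real (card A) * \<epsilon>) * S"
  proof -
    have "(\<Sum>n\<in>A. \<Sum>m\<in>A. w n m * (norm (a n))\<^sup>2) = (\<Sum>n\<in>A. (\<Sum>m\<in>A. w n m) * (norm (a n))\<^sup>2)"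
      by (simp add: sum_distrib_right)
    also have "\<dots> \<le> (\<Sum>n\<in>A. (\<rho> + real (card A) * \<epsilon>) * (norm (a n))\<^sup>2)"
      by (intro sum_mono mult_right_mono rows) auto
    finally show ?thesis by (simp add: S_def sum_distrib_left)
  qed
  have half': "(\<Sum>n\<in>A. \<Sum>m\<in>A. w n m * (norm (a m))\<^sup>2) \<le> (\<rho> + real (card A) * \<epsilon>) * S"
  proof -
    have "(\<Sum>n\<in>A. \<Sum>m\<in>A. w n m * (norm (a m))\<^sup>2) = (\<Sum>m\<in>A. \<Sum>n\<in>A. w m n * (norm (a m))\<^sup>2)"
      by (subst sum.swap) (simp add: wsym)
    then show ?thesis using half by simp
  qed
  have diag: "(\<Sum>n\<in>A. \<Sum>m\<in>A. d n m * (L * (norm (a n))\<^sup>2)) = L * S"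
  proof -
    have "(\<Sum>m\<in>A. d n m * (L * (norm (a n))\<^sup>2)) = L * (norm (a n))\<^sup>2" if "n \<in> A" for n
      using fin that by (simp add: d_def if_distribR flip: sum_distrib_right)
    then show ?thesis by (simp add: S_def sum_distrib_left)
  qed
  have "(\<Sum>n\<in>A. \<Sum>m\<in>A. d n m * (L * (norm (a n))\<^sup>2) - w n m * (((norm (a n))\<^sup>2 + (norm (a m))\<^sup>2) / 2))
    = L * S - ((\<Sum>n\<in>A. \<Sum>m\<in>A. w n m * (norm (a n))\<^sup>2) + (\<Sum>n\<in>A. \<Sum>m\<in>A. w n m * (norm (a m))\<^sup>2)) / 2"
    unfolding diag[symmetric]
    by (simp add: sum_subtractf sum.distrib sum_divide_distrib distrib_left add_divide_distrib)
  moreover have "\<dots> \<ge> L * S - (\<rho> + real (card A) * \<epsilon>) * S" using half half' by simp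
  moreover have "(\<Sum>n\<in>A. \<Sum>m\<in>A. d n m * (L * (norm (a n))\<^sup>2) - w n m * (((norm (a n))\<^sup>2 + (norm (a m))\<^sup>2) / 2))
    \<le> (\<Sum>n\<in>A. \<Sum>m\<in>A. Re (a n * cnj (a m) * s (n - m)))"
    by (intro sum_mono entry)
  moreover have "\<dots> = Re (\<Sum>n\<in>A. \<Sum>m\<in>A. a n * cnj (a m) * s (n - m))" by (simp only: Re_sum)
  moreover have "(L - \<rho> - real (card A) * \<epsilon>) * S = L * S - (\<rho> + real (card A) * \<epsilon>) * S"
    by (simp add: algebra_simps)
  ultimately show ?thesis unfolding S_def[symmetric] by linarith
qed

lemma integral_square_on_curve:
  assumes cg: "continuous_on {0..L} \<gamma>" and cF: "continuous_on UNIV F" and fin: "finite A"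
    and exp: "\<And>x. complex_of_real (F x) = (\<Sum>n\<in>A. a n * wave n (x $ 1) (x $ 2))"
  shows "complex_of_real (integral {0..L} (\<lambda>t. (F (\<gamma> t))\<^sup>2))
    = (\<Sum>n\<in>A. \<Sum>m\<in>A. a n * cnj (a m) * curve_fourier L \<gamma> (lattice_vec (n - m)))"
proof -
  have e: "complex_of_real (F x) = (\<Sum>n\<in>A. a n * cis (lattice_vec n \<bullet> x))" for x
    using exp[of x] by (simp add: wave_eq_cis_inner)
  have sq: "complex_of_real ((F x)\<^sup>2) = (\<Sum>n\<in>A. \<Sum>m\<in>A. a n * cnj (a m) * cis (lattice_vec (n - m) \<bullet> x))" for x
  proof -
    have "complex_of_real ((F x)\<^sup>2) = complex_of_real (F x) * cnj (complex_of_real (F x))"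
      by (simp add: power2_eq_square)
    also have "\<dots> = (\<Sum>n\<in>A. \<Sum>m\<in>A. (a n * cis (lattice_vec n \<bullet> x)) * cnj (a m * cis (lattice_vec m \<bullet> x)))"
      unfolding e by (simp add: sum_product)
    also have "\<dots> = (\<Sum>n\<in>A. \<Sum>m\<in>A. a n * cnj (a m) * cis (lattice_vec (n - m) \<bullet> x))"
    proof (intro sum.cong refl)
      fix n m
      have "cis (lattice_vec (n - m) \<bullet> x) = cis (lattice_vec n \<bullet> x) * cis (- (lattice_vec m \<bullet> x))"
        by (simp add: cis_mult lattice_vec_diff inner_diff_left)
      then show "(a n * cis (lattice_vec n \<bullet> x)) * cnj (a m * cis (lattice_vec m \<bullet> x)) = a n * cnj (a m) * cis (lattice_vec (n - m) \<bullet> x)"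
        by (simp add: cis_cnj)
    qed
    finally show ?thesis .
  qed
  have i: "(\<lambda>t. c * cis (\<xi> \<bullet> \<gamma> t)) integrable_on {0..L}" for c \<xi>
    by (intro integrable_continuous_real continuous_intros cg)
  have "complex_of_real (integral {0..L} (\<lambda>t. (F (\<gamma> t))\<^sup>2)) = integral {0..L} (\<lambda>t. complex_of_real ((F (\<gamma> t))\<^sup>2))"
    by (intro integral_complex_of_real[symmetric] integrable_continuous_real continuous_intros
        continuous_on_compose2[OF cF cg]) auto
  also have "\<dots> = (\<Sum>n\<in>A. \<Sum>m\<in>A. integral {0..L} (\<lambda>t. a n * cnj (a m) * cis (lattice_vec (n - m) \<bullet> \<gamma> t)))"
    unfolding sq using fin by (simp add: integral_sum integrable_sum i)
  finally show ?thesis by (simp add: curve_fourier_def)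
qed

text \<open>
  The restriction theorem of Bourgain and Rudnick: the pairs of close frequencies cost \<open>\<rho> < L\<close>, and
  for large \<open>lam\<close> all remaining interactions together cost at most \<open>(L - \<rho>) / 2\<close>.
\<close>

lemma restriction_L2_lower_bound:
  assumes curve: "smooth_arclength_curve L \<gamma>" and curv: "\<forall>t\<in>{0..L}. curvature L \<gamma> t \<noteq> 0"
  shows "\<exists>c>0. \<exists>\<Lambda>. \<forall>lam F. lam \<ge> \<Lambda> \<longrightarrow> torus_eigenfunction lam F \<longrightarrow>
    torus_L2_norm F > 0 \<and> c * (torus_L2_norm F)\<^sup>2 \<le> integral {0..L} (\<lambda>t. (F (\<gamma> t))\<^sup>2)"
proof -
  have L: "L > 0" using curve by (simp add: smooth_arclength_curve_def)
  have cg: "continuous_on {0..L} \<gamma>"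
    by (rule smooth_arclength_curve_continuous[OF curve])
  obtain C where C: "C > 0" "\<And>\<xi>. norm \<xi> \<ge> 1 \<Longrightarrow> norm (curve_fourier L \<gamma> \<xi>) \<le> C / sqrt (norm \<xi>)"
    using curve_oscillatory_decay[OF curve curv] by blast
  obtain \<rho> where rho: "\<rho> < L" "0 \<le> \<rho>" "\<And>n. n \<noteq> 0 \<Longrightarrow> norm (curve_fourier L \<gamma> (lattice_vec n)) \<le> \<rho>"
    using curve_oscillatory_gap[OF curve curv] by blast
  obtain \<Lambda> where Lam: "\<Lambda> \<ge> 4" "\<And>lam N. lam \<ge> \<Lambda> \<Longrightarrow> lam\<^sup>2 = real N \<Longrightarrow>
    real (card (lattice_circle N)) * (C / sqrt ((2 * lam) powr (1/3) / 2)) \<le> (L - \<rho>) / 2"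
    using few_lattice_points_eventually[OF C(1), of "(L - \<rho>) / 2"] rho by auto
  define c where "c = (L - \<rho>) / 2 / (2 * pi)\<^sup>2"
  have c: "c > 0" using rho by (simp add: c_def)
  have "torus_L2_norm F > 0 \<and> c * (torus_L2_norm F)\<^sup>2 \<le> integral {0..L} (\<lambda>t. (F (\<gamma> t))\<^sup>2)"
    if lam: "lam \<ge> \<Lambda>" and ef: "torus_eigenfunction lam F" for lam F
  proof -
    have dF: "\<And>x. F differentiable (at x)" and "\<exists>x. F x \<noteq> 0"
      using ef by (auto simp: torus_eigenfunction_def numeral_2_eq_2)
    then obtain x0 where x0: "F x0 \<noteq> 0" by blast
    have cF: "continuous_on UNIV F"
      using dF by (meson continuous_at_imp_continuous_on differentiable_imp_continuous_within)
    define A where "A = {n. (real_of_int (fst n))\<^sup>2 + (real_of_int (snd n))\<^sup>2 = lam\<^sup>2}"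
    have "A \<noteq> {}"
    proof
      assume "A = {}"
      then have "complex_of_real (F x0) = 0"
        using torus_eigenfunction_expansion[OF ef A_def] by auto
      then show False using x0 by simp
    qed
    then obtain n0 where n0: "n0 \<in> A" by blast
    define N where "N = nat ((fst n0)\<^sup>2 + (snd n0)\<^sup>2)"
    have N: "lam\<^sup>2 = real N" using n0 by (simp add: A_def N_def)
    have AN: "A = lattice_circle N"
    proof -
      have "(real_of_int k)\<^sup>2 + (real_of_int l)\<^sup>2 = real N \<longleftrightarrow> k\<^sup>2 + l\<^sup>2 = int N" for k l
        using of_int_eq_iff[of "k\<^sup>2 + l\<^sup>2" "int N", where 'a = real] by simp
      then show ?thesis unfolding A_def N lattice_circle_def case_prod_beta by simp
    qed
    have fin: "finite A" unfolding AN by (rule finite_lattice_circle)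
    from torus_eigenfunction_expansion[OF ef A_def fin] obtain a
      where a: "\<And>x. complex_of_real (F x) = (\<Sum>n\<in>A. a n * wave n (x $ 1) (x $ 2))"
      by (elim exE) simp
    define S where "S = (\<Sum>n\<in>A. (norm (a n))\<^sup>2)"
    have norm: "(torus_L2_norm F)\<^sup>2 = (2 * pi)\<^sup>2 * S"
      unfolding S_def by (rule torus_L2_norm_expansion[OF cF fin a])
    have "S \<noteq> 0"
    proof
      assume "S = 0"
      then have "\<forall>n\<in>A. a n = 0" unfolding S_def using fin by (simp add: sum_nonneg_eq_0_iff)
      then have "complex_of_real (F x0) = 0" unfolding a by simp
      then show False using x0 by simp
    qed
    moreover have "torus_L2_norm F \<ge> 0"
      unfolding torus_L2_norm_def
      by (intro real_sqrt_ge_zero integral_nonneg integrable_continuous continuous_intros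
          continuous_on_subset[OF cF]) auto
    ultimately have pos: "torus_L2_norm F > 0" using norm by (cases "torus_L2_norm F = 0") auto
    \<comment> \<open>Jarnik's scale: \<open>D ^ 6 = 4 * lam\<^sup>2\<close>.\<close>
    define D where "D = (2 * lam) powr (1/3)"
    have D2: "D \<ge> 2"
    proof -
      have "(8::real) powr (1/3) \<le> D" unfolding D_def using lam Lam(1) by (intro powr_mono2) auto
      moreover have "(8::real) powr (1/3) = 2"
      proof -
        have "(8::real) = 2 powr 3" by simp
        then have "(8::real) powr (1/3) = 2 powr (3 * (1/3))" by (metis powr_powr)
        then show ?thesis by simp
      qed
      ultimately show ?thesis by simp
    qed
    have D6: "D ^ 6 \<le> 4 * real N"
    proof -
      have "D ^ 6 = (2 * lam)\<^sup>2" using lam Lam(1) by (simp add: D_def powr_power)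
      then show ?thesis using N by (simp add: power_mult_distrib)
    qed
    define \<epsilon> where "\<epsilon> = C / sqrt (D / 2)"
    have eps0: "\<epsilon> \<ge> 0" using C D2 by (simp add: \<epsilon>_def)
    have "(L - \<rho> - real (card A) * \<epsilon>) * S
        \<le> Re (\<Sum>n\<in>A. \<Sum>m\<in>A. a n * cnj (a m) * curve_fourier L \<gamma> (lattice_vec (n - m)))"
      unfolding S_def
    proof (rule quadratic_form_lower_bound[OF fin, of "\<lambda>n. curve_fourier L \<gamma> (lattice_vec n)" L \<rho> "\<lambda>n m. norm (lattice_vec (n - m)) < D / 2"])
      have "lattice_vec 0 = 0" by (simp add: lattice_vec_eq_0_iff)
      then show "curve_fourier L \<gamma> (lattice_vec 0) = of_real L" using L by (simp add: curve_fourier_def scaleR_conv_of_real)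
      show "norm (curve_fourier L \<gamma> (lattice_vec (n - m))) \<le> \<epsilon>" if "\<not> norm (lattice_vec (n - m)) < D / 2" for n m
      proof -
        have "norm (curve_fourier L \<gamma> (lattice_vec (n - m))) \<le> C / sqrt (norm (lattice_vec (n - m)))"
          using that D2 by (intro C(2)) auto
        also have "\<dots> \<le> \<epsilon>" unfolding \<epsilon>_def
          using that D2 C by (intro divide_left_mono real_sqrt_le_mono mult_pos_pos) auto
        finally show ?thesis .
      qed
      show "norm (lattice_vec (n - m)) < D / 2 \<longleftrightarrow> norm (lattice_vec (m - n)) < D / 2" for n m
        by (simp add: lattice_vec_diff norm_minus_commute)
      show "card {m \<in> A. m \<noteq> n \<and> norm (lattice_vec (n - m)) < D / 2} \<le> 1" if "n \<in> A" for n
        using at_most_one_close_lattice_point[OF _ D6] D2 that unfolding AN by simp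
    qed (use rho eps0 in auto)
    also have "\<dots> = integral {0..L} (\<lambda>t. (F (\<gamma> t))\<^sup>2)"
      unfolding integral_square_on_curve[OF cg cF fin a, symmetric] by simp
    finally have Q: "(L - \<rho> - real (card A) * \<epsilon>) * S \<le> integral {0..L} (\<lambda>t. (F (\<gamma> t))\<^sup>2)" .
    have "real (card A) * \<epsilon> \<le> (L - \<rho>) / 2"
      unfolding AN \<epsilon>_def D_def by (rule Lam(2)[OF lam N])
    moreover have "S \<ge> 0" by (simp add: S_def sum_nonneg)
    ultimately have "(L - \<rho>) / 2 * S \<le> (L - \<rho> - real (card A) * \<epsilon>) * S"
      by (intro mult_right_mono) auto
    moreover have "c * (torus_L2_norm F)\<^sup>2 = (L - \<rho>) / 2 * S" unfolding norm c_def by simp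
    ultimately show ?thesis using Q pos by simp
  qed
  then show ?thesis using c by blast
qed

text \<open>
  The case of Hoelder's inequality that interpolates \<open>L^2\<close> between \<open>L^1\<close> and \<open>L^4\<close>. It comes from
  \<open>3 g^2 \<le> 2 g + g^4\<close> for \<open>g \<ge> 0\<close>, applied to \<open>g = f / \<alpha>\<close>, integrated, and optimized over the
  scale \<open>\<alpha>\<close>.
\<close>

lemma integral_interpolation_1_2_4:
  fixes f :: "real \<Rightarrow> real"
  assumes cf: "continuous_on {0..L} f" and f0: "\<And>t. f t \<ge> 0"
    and Qpos: "integral {0..L} (\<lambda>t. (f t)\<^sup>2) > 0"
  shows "integral {0..L} f > 0"
    and "(integral {0..L} (\<lambda>t. (f t)\<^sup>2)) ^ 3 \<le> (integral {0..L} f)\<^sup>2 * integral {0..L} (\<lambda>t. f t ^ 4)"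
proof -
  define P Q B where "P = integral {0..L} f" "Q = integral {0..L} (\<lambda>t. (f t)\<^sup>2)"
    "B = integral {0..L} (\<lambda>t. f t ^ 4)"
  have i: "f integrable_on {0..L}" "(\<lambda>t. (f t)\<^sup>2) integrable_on {0..L}" "(\<lambda>t. f t ^ 4) integrable_on {0..L}"
    by (intro integrable_continuous_real continuous_intros cf)+
  have P0: "P \<ge> 0" and B0: "B \<ge> 0"
    unfolding P_Q_B_def using i f0 by (auto intro!: integral_nonneg)
  have young: "3 * Q \<le> 2 * \<alpha> * P + B / \<alpha>\<^sup>2" if al: "\<alpha> > 0" for \<alpha>
  proof -
    have ptw: "3 * (f t)\<^sup>2 \<le> 2 * \<alpha> * f t + (1 / \<alpha>\<^sup>2) * f t ^ 4" for t
    proof -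
      define g where "g = f t / \<alpha>"
      have fg: "f t = \<alpha> * g" using al by (simp add: g_def)
      have "g \<ge> 0" using f0 al by (simp add: g_def)
      then have "0 \<le> g * ((g - 1)\<^sup>2 * (g + 2))" by simp
      also have "\<dots> = 2 * g + g ^ 4 - 3 * g\<^sup>2"
        by (simp add: power2_eq_square power4_eq_xxxx algebra_simps)
      finally have "\<alpha>\<^sup>2 * (3 * g\<^sup>2) \<le> \<alpha>\<^sup>2 * (2 * g + g ^ 4)" by (intro mult_left_mono) auto
      moreover have "(1 / \<alpha>\<^sup>2) * (\<alpha> * g) ^ 4 = \<alpha>\<^sup>2 * g ^ 4"
        using al by (simp add: power_mult_distrib power2_eq_square power4_eq_xxxx)
      ultimately show ?thesis unfolding fg
        by (simp add: power_mult_distrib power2_eq_square algebra_simps)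
    qed
    have "3 * Q = integral {0..L} (\<lambda>t. 3 * (f t)\<^sup>2)" by (simp add: P_Q_B_def)
    also have "\<dots> \<le> integral {0..L} (\<lambda>t. 2 * \<alpha> * f t + (1 / \<alpha>\<^sup>2) * f t ^ 4)"
      by (intro integral_le integrable_add integrable_on_mult_right i ptw)
    also have "\<dots> = 2 * \<alpha> * P + (1 / \<alpha>\<^sup>2) * B"
      unfolding P_Q_B_def
      by (subst integral_add) (intro integrable_on_mult_right i | simp only: integral_mult_right)+
    finally show ?thesis by simp
  qed
  have Q0: "Q > 0" using Qpos by (simp add: P_Q_B_def)
  show P1: "integral {0..L} f > 0"
  proof (rule ccontr)
    assume "\<not> integral {0..L} f > 0"
    then have "P = 0" using P0 by (simp add: P_Q_B_def)
    \<comment> \<open>A scale so large that the term with \<open>B\<close> falls below \<open>Q\<close>.\<close>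
    define \<alpha> where "\<alpha> = sqrt ((B + 1) / Q)"
    have al: "\<alpha> > 0" "\<alpha>\<^sup>2 = (B + 1) / Q" using B0 Q0 by (auto simp: \<alpha>_def)
    have "3 * Q \<le> B / ((B + 1) / Q)" using young[OF al(1)] \<open>P = 0\<close> al(2) by simp
    also have "\<dots> = (B / (B + 1)) * Q" by simp
    also have "\<dots> \<le> 1 * Q" using B0 Q0 by (intro mult_right_mono) auto
    finally show False using Q0 by simp
  qed
  have P: "P > 0" using P1 by (simp add: P_Q_B_def)
  \<comment> \<open>At \<open>\<alpha> = Q / P\<close> the first term on the right absorbs two of the three copies of \<open>Q\<close>.\<close>
  have "3 * Q \<le> 2 * (Q / P) * P + B / (Q / P)\<^sup>2" using P Q0 by (intro young) simp
  then have "Q \<le> B * P\<^sup>2 / Q\<^sup>2" using P by (simp add: power_divide)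
  then have "Q * Q\<^sup>2 \<le> B * P\<^sup>2" using Q0 by (simp add: pos_le_divide_eq)
  then show "(integral {0..L} (\<lambda>t. (f t)\<^sup>2)) ^ 3 \<le> (integral {0..L} f)\<^sup>2 * integral {0..L} (\<lambda>t. f t ^ 4)"
    by (simp add: P_Q_B_def power3_eq_cube power2_eq_square mult_ac)
qed

theorem mainTheorem4:
  fixes L :: real and \<gamma> :: "real \<Rightarrow> real ^ 2"
  assumes "smooth_arclength_curve L \<gamma>"
    and "\<forall>t\<in>{0..L}. curvature L \<gamma> t \<noteq> 0"
  shows "\<exists>c>0. \<exists>\<Lambda>. \<forall>lam F. lam \<ge> \<Lambda> \<longrightarrow> torus_eigenfunction lam F \<longrightarrow>
           curve_Lp_norm 4 L \<gamma> F > 0 \<and>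
           curve_Lp_norm 1 L \<gamma> F \<ge> c * (torus_L2_norm F ^ 3 / (curve_Lp_norm 4 L \<gamma> F)\<^sup>2)"
proof -
  obtain c \<Lambda> where c: "c > 0" and bound: "\<And>lam F. lam \<ge> \<Lambda> \<Longrightarrow> torus_eigenfunction lam F \<Longrightarrow>
    torus_L2_norm F > 0 \<and> c * (torus_L2_norm F)\<^sup>2 \<le> integral {0..L} (\<lambda>t. (F (\<gamma> t))\<^sup>2)"
    using restriction_L2_lower_bound[OF assms] by blast
  have cg: "continuous_on {0..L} \<gamma>"
    by (rule smooth_arclength_curve_continuous[OF assms(1)])
  have "curve_Lp_norm 4 L \<gamma> F > 0 \<and>
      curve_Lp_norm 1 L \<gamma> F \<ge> sqrt c ^ 3 * (torus_L2_norm F ^ 3 / (curve_Lp_norm 4 L \<gamma> F)\<^sup>2)"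
    if lam: "lam \<ge> \<Lambda>" and ef: "torus_eigenfunction lam F" for lam F
  proof -
    define X where "X = torus_L2_norm F"
    define f where "f t = \<bar>F (\<gamma> t)\<bar>" for t
    define P Q B where "P = integral {0..L} f" "Q = integral {0..L} (\<lambda>t. (f t)\<^sup>2)"
      "B = integral {0..L} (\<lambda>t. f t ^ 4)"
    have dF: "\<And>x. F differentiable (at x)"
      using ef by (auto simp: torus_eigenfunction_def numeral_2_eq_2)
    have cF: "continuous_on UNIV F"
      using dF by (meson continuous_at_imp_continuous_on differentiable_imp_continuous_within)
    have cf: "continuous_on {0..L} f"
      unfolding f_def by (intro continuous_intros continuous_on_compose2[OF cF cg]) auto
    have X: "X > 0" and QX: "c * X\<^sup>2 \<le> Q"
      using bound[OF lam ef] by (auto simp: X_def P_Q_B_def f_def)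
    have Q: "Q > 0" using QX mult_pos_pos[OF c zero_less_power[OF X, of 2]] by linarith
    have f0: "f t \<ge> 0" for t by (simp add: f_def)
    have P: "P > 0" and PB: "Q ^ 3 \<le> P\<^sup>2 * B"
      using integral_interpolation_1_2_4[OF cf f0 Q[unfolded P_Q_B_def]] by (simp_all only: P_Q_B_def)
    have "0 < P\<^sup>2 * B" using PB zero_less_power[OF Q, of 3] by linarith
    then have B: "B > 0" using P by (simp add: zero_less_mult_iff)
    have n1: "curve_Lp_norm 1 L \<gamma> F = P"
    proof -
      have "curve_Lp_norm 1 L \<gamma> F = \<bar>P\<bar>" by (simp add: curve_Lp_norm_def P_Q_B_def f_def[abs_def])
      then show ?thesis using P by simp
    qed
    have n4: "curve_Lp_norm 4 L \<gamma> F = B powr (1/4)"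
      by (simp add: curve_Lp_norm_def P_Q_B_def f_def)
    have sqB: "(B powr (1/4))\<^sup>2 = sqrt B"
      using B by (simp add: powr_power powr_half_sqrt)
    have "(sqrt c * X) ^ 3 \<le> P * sqrt B"
    proof (rule power2_le_imp_le)
      have "((sqrt c * X) ^ 3)\<^sup>2 = ((sqrt c * X)\<^sup>2) ^ 3" by (simp flip: power_mult)
      also have "\<dots> = (c * X\<^sup>2) ^ 3" using c by (simp add: power_mult_distrib)
      also have "\<dots> \<le> Q ^ 3" using c by (intro power_mono QX) auto
      also have "\<dots> \<le> (P * sqrt B)\<^sup>2" using PB B by (simp add: power_mult_distrib)
      finally show "((sqrt c * X) ^ 3)\<^sup>2 \<le> (P * sqrt B)\<^sup>2" .
    qed (use P B in simp)
    then have "sqrt c ^ 3 * (X ^ 3 / sqrt B) \<le> P"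
      using B by (simp add: power_mult_distrib pos_divide_le_eq)
    then show ?thesis using B by (simp add: n1 n4 sqB X_def)
  qed
  moreover have "sqrt c ^ 3 > 0" using c by simp
  ultimately show ?thesis by blast
qed

end
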